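(* $$Z(1) = \Lambda^{\mathrm{bal}}_{\mathrm{odd}} \setminus \bigcup_{m>0} B\bigl(p^m\Lambda^{\mathrm{bal}}_{\mathrm{odd}},\, p^m\bigr).$$
   Context: Let $p$ be a prime, $\mathbb{F}=\mathbb{F}_p$, $S=\mathbb{F}[x,y]$, $\mathrm{Der}_S = S\partial_x\oplus S\partial_y$. Let $\mathcal{A}=\{H_1,H_2,H_3\}$ with $H_1=\ker x$, $H_2=\ker y$, $H_3=\ker(x+y)$, $\alpha_1=x,\alpha_2=y,\alpha_3=x+y$. For $\mu=(\mu_1,\mu_2,\mu_3)\in\Lambda\coloneqq\mathbb{Z}_{\ge0}^3$, $D(\mathcal{A},\mu)=\{\theta\in\mathrm{Der}_S:\theta(\alpha_i)\in\alpha_i^{\mu_i}S,\ i=1,2,3\}$; it is free of rank 2 with a homogeneous basis whose degrees (the exponents) are unique up to order and sum to $|\mu|=\mu_1+\mu_2+\mu_3$; $\Delta(\mu)$ denotes the absolute difference of the two exponents. $\mu$ is balanced if $\mu_i\le|\mu|/2$ for all $i$; $\Lambda^{\mathrm{bal}}$ is the set of balanced elements, $\Lambda_{>0}=\{\mu:\Delta(\mu)>0\}$, $\Lambda^{\mathrm{bal}}_{>0}=\Lambda^{\mathrm{bal}}\cap\Lambda_{>0}$, $\Lambda^{\mathrm{bal}}_{\mathrm{odd}}=\{\mu\in\Lambda^{\mathrm{bal}}:|\mu|\text{ odd}\}$. Two elements $\mu,\nu\in\Lambda$ are adjacent if $\mu-\nu=\pm\mathbf{e}_i$ for some $i$; connected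 components of $\Lambda_{>0}$ are the equivalence classes of the equivalence relation on $\Lambda_{>0}$ generated by adjacency. $B(\zeta,r)=\{\mu\in\Lambda:|\mu-\zeta|<r\}$, $B(T,r)=\bigcup_{\zeta\in T}B(\zeta,r)$, $cT=\{c\nu:\nu\in T\}$. It is known (Abe–Numata) that $\Lambda^{\mathrm{bal}}_{>0}$ is a union of connected components of $\Lambda_{>0}$ (the connected components of $\Lambda^{\mathrm{bal}}_{>0}$), and each such component $C$ equals $B(\zeta,\Delta(\zeta))$ for a unique $\zeta\in C$, its center, characterized as the unique element of $C$ with $\Delta(\zeta)>\Delta(\nu)$ for every $\nu$ adjacent to $\zeta$. $Z$ is the set of centers of the connected components of $\Lambda^{\mathrm{bal}}_{>0}$, and $Z(p^k)=\{\zeta\in Z:\Delta(\zeta)=p^k\}$; in particular $Z(1)=\{\zeta\in Z:\Delta(\zeta)=1\}$. *)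

theory Defs
  imports "HOL-Analysis.Finite_Cartesian_Product" "HOL-Library.Numeral_Type"
    "HOL-Library.Product_Plus" "HOL-Computational_Algebra.Polynomial"
    "HOL-Computational_Algebra.Primes"
begin

text \<open>
  The polynomial ring in two variables over a field \<open>'k\<close> is modelled as \<open>'k[x][y]\<close>:
  the coefficient of \<open>x\<^sup>i y\<^sup>j\<close> in \<open>f\<close> is \<open>coeff (coeff f j) i\<close>.
\<close>

type_synonym 'k bpoly = "'k poly poly"

definition var_x :: "'k::field bpoly" where "var_x = [:[:0, 1:]:]"
definition var_y :: "'k::field bpoly" where "var_y = [:0, 1:]"

definition deriv_x :: "'k::field bpoly \<Rightarrow> 'k bpoly" where "deriv_x = map_poly pderiv"
definition deriv_y :: "'k::field bpoly \<Rightarrow> 'k bpoly" where "deriv_y = pderiv"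

definition homogeneous :: "nat \<Rightarrow> 'k::field bpoly \<Rightarrow> bool" where
  "homogeneous d f \<longleftrightarrow> (\<forall>i j. coeff (coeff f j) i \<noteq> 0 \<longrightarrow> i + j = d)"

text \<open>The pair \<open>(f, g)\<close> stands for the derivation \<open>f \<partial>\<^sub>x + g \<partial>\<^sub>y\<close>.\<close>

type_synonym 'k der = "'k bpoly \<times> 'k bpoly"

definition der_apply :: "'k::field der \<Rightarrow> 'k bpoly \<Rightarrow> 'k bpoly" where
  "der_apply \<theta> h = fst \<theta> * deriv_x h + snd \<theta> * deriv_y h"

definition der_scale :: "'k::field bpoly \<Rightarrow> 'k der \<Rightarrow> 'k der" where
  "der_scale a \<theta> = (a * fst \<theta>, a * snd \<theta>)"

interpretation der: module "der_scale :: 'k::field bpoly \<Rightarrow> 'k der \<Rightarrow> 'k der"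
  by unfold_locales (simp_all add: der_scale_def algebra_simps)

text \<open>The degree of a homogeneous derivation is the polynomial degree of its coefficients.\<close>

definition der_homogeneous :: "nat \<Rightarrow> 'k::field der \<Rightarrow> bool" where
  "der_homogeneous d \<theta> \<longleftrightarrow> homogeneous d (fst \<theta>) \<and> homogeneous d (snd \<theta>)"

text \<open>
  In the index type \<open>3\<close> the three elements are \<open>1\<close>, \<open>2\<close> and \<open>3 = 0\<close>.
  A multiplicity \<open>\<mu>\<close> is an element of \<open>nat ^ 3\<close>.
\<close>

definition lin_form :: "3 \<Rightarrow> 'k::field bpoly" where
  "lin_form i = (if i = 1 then var_x else if i = 2 then var_y else var_x + var_y)"

definition log_der :: "nat ^ 3 \<Rightarrow> 'k::field der set" where
  "log_der \<mu> = {\<theta>. \<forall>i. lin_form i ^ (\<mu> $ i) dvd der_apply \<theta> (lin_form i)}"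

definition exponents :: "'k::field itself \<Rightarrow> nat ^ 3 \<Rightarrow> nat \<Rightarrow> nat \<Rightarrow> bool" where
  "exponents K \<mu> d1 d2 \<longleftrightarrow> (\<exists>\<theta>1 \<theta>2 :: 'k der. \<theta>1 \<noteq> \<theta>2 \<and>
     der.independent {\<theta>1, \<theta>2} \<and> der.span {\<theta>1, \<theta>2} = log_der \<mu> \<and>
     der_homogeneous d1 \<theta>1 \<and> der_homogeneous d2 \<theta>2)"

text \<open>
  The description is well-formed because \<open>log_der \<mu>\<close> is free of rank two with a homogeneous
  basis whose degrees are unique up to order.
\<close>

definition Delta :: "'k::field itself \<Rightarrow> nat ^ 3 \<Rightarrow> nat" where
  "Delta K \<mu> = (THE \<delta>. \<exists>d1 d2. exponents K \<mu> d1 d2 \<and> int \<delta> = \<bar>int d1 - int d2\<bar>)"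

definition total :: "nat ^ 3 \<Rightarrow> nat" where
  "total \<mu> = (\<Sum>i\<in>UNIV. \<mu> $ i)"

definition balanced :: "(nat ^ 3) set" where
  "balanced = {\<mu>. \<forall>i. real (\<mu> $ i) \<le> real (total \<mu>) / 2}"

definition balanced_odd :: "(nat ^ 3) set" where
  "balanced_odd = {\<mu> \<in> balanced. odd (total \<mu>)}"

definition positive :: "'k::field itself \<Rightarrow> (nat ^ 3) set" where
  "positive K = {\<mu>. Delta K \<mu> > 0}"

definition adjacency :: "((nat ^ 3) \<times> (nat ^ 3)) set" where
  "adjacency = {(\<mu>, \<nu>). \<exists>i. \<mu> = \<nu> + axis i 1 \<or> \<nu> = \<mu> + axis i 1}"

text \<open>Since adjacency is symmetric, the reflexive transitive closure is the generated equivalence.\<close>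

definition components :: "(nat ^ 3) set \<Rightarrow> (nat ^ 3) set set" where
  "components T = T // (Restr adjacency T)\<^sup>*"

text \<open>Balls are taken with respect to the \<open>\<ell>\<^sup>1\<close>-distance, which extends \<open>total\<close> to differences.\<close>

definition l1_dist :: "nat ^ 3 \<Rightarrow> nat ^ 3 \<Rightarrow> int" where
  "l1_dist \<mu> \<nu> = (\<Sum>i\<in>UNIV. \<bar>int (\<mu> $ i) - int (\<nu> $ i)\<bar>)"

definition l1_ball :: "nat ^ 3 \<Rightarrow> nat \<Rightarrow> (nat ^ 3) set" where
  "l1_ball \<zeta> r = {\<mu>. l1_dist \<mu> \<zeta> < int r}"

definition l1_balls :: "(nat ^ 3) set \<Rightarrow> nat \<Rightarrow> (nat ^ 3) set" where
  "l1_balls T r = (\<Union>\<zeta>\<in>T. l1_ball \<zeta> r)"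

definition is_center :: "'k::field itself \<Rightarrow> (nat ^ 3) set \<Rightarrow> nat ^ 3 \<Rightarrow> bool" where
  "is_center K C \<zeta> \<longleftrightarrow> \<zeta> \<in> C \<and> C = l1_ball \<zeta> (Delta K \<zeta>)"

definition centers :: "'k::field itself \<Rightarrow> (nat ^ 3) set" where
  "centers K = {\<zeta>. \<exists>C \<in> components (positive K). C \<subseteq> balanced \<inter> positive K \<and> is_center K C \<zeta>}"

definition centers_of_Delta :: "'k::field itself \<Rightarrow> nat \<Rightarrow> (nat ^ 3) set" where
  "centers_of_Delta K n = {\<zeta> \<in> centers K. Delta K \<zeta> = n}"

end

theory Submission
  imports Defs "HOL-Analysis.Cartesian_Space" "HOL-Computational_Algebra.Polynomial_Factorial"
begin

text \<open>
  Write \<open>\<Delta>(\<mu>) = |\<mu>| - 2 d(\<mu>)\<close>, where \<open>d(\<mu>)\<close> is the least degree of a nonzero homogeneous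
  element of \<open>D(A, \<mu>)\<close>. Then \<open>\<Delta>\<close> changes by exactly one along an edge, vanishes on the boundary
  of the balanced cone, and satisfies \<open>\<Delta>(p\<mu>) \<ge> p \<Delta>(\<mu>)\<close> because Frobenius maps \<open>D(A, \<mu>)\<close> to
  \<open>D(A, p\<mu>)\<close>. Hence \<open>\<Delta> > 0\<close> on the balls \<open>B(p\<^sup>m\<nu>, p\<^sup>m)\<close> with \<open>|\<nu>|\<close> odd, so that for \<open>m > 0\<close> they
  contain no point of \<open>Z(1)\<close>.

  Conversely, let \<open>\<theta>\<close> have least degree at a local maximum \<open>\<mu>\<close> with \<open>\<Delta>(\<mu>) \<ge> 2\<close>. Applying a partial
  derivative to the coefficients of \<open>\<theta>\<close> yields zero, since otherwise a neighbour of \<open>\<mu>\<close> would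
  admit a derivation of too small a degree. So \<open>\<theta>\<close> is a Frobenius power, \<open>\<mu> = p\<nu>\<close> and
  \<open>\<Delta>(\<mu>) = p \<Delta>(\<nu>)\<close>; iterating gives \<open>\<mu> = p\<^sup>m\<nu>\<close> with \<open>\<Delta>(\<nu>) = 1\<close>. A balanced point with \<open>\<Delta> \<ge> 2\<close>
  climbs to such a local maximum at distance at most \<open>p\<^sup>m - \<Delta>\<close>.
\<close>

subsection \<open>Homogeneous polynomials in two variables\<close>

text \<open>Extraction of the component of degree \<open>d\<close> turns homogeneity into a
  fixed-point equation (\<open>homogeneous_iff_hcomp\<close>), so that closure and cancellation
  reduce to rewriting.\<close>

definition hcomp :: "nat \<Rightarrow> 'k::field bpoly \<Rightarrow> 'k bpoly" where
  "hcomp d f = (\<Sum>j\<le>d. monom (monom (coeff (coeff f j) (d - j)) (d - j)) j)"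

lemma coeff_hcomp:
  "coeff (coeff (hcomp d f) j) i = (if i + j = d then coeff (coeff f j) i else 0)"
  unfolding hcomp_def by (auto simp: coeff_sum if_distrib[of "\<lambda>p. coeff p _"] cong: if_cong)

lemma bpoly_eqI: "(\<And>i j. coeff (coeff f j) i = coeff (coeff g j) i) \<Longrightarrow> f = g"
  by (auto intro!: poly_eqI)

lemma homogeneousD: "homogeneous d f \<Longrightarrow> i + j \<noteq> d \<Longrightarrow> coeff (coeff f j) i = 0"
  by (auto simp: homogeneous_def)

lemma homogeneous_iff_hcomp: "homogeneous d f \<longleftrightarrow> hcomp d f = f"
proof
  assume "homogeneous d f"
  then show "hcomp d f = f"
    by (intro bpoly_eqI) (auto simp: coeff_hcomp homogeneous_def)
next
  assume "hcomp d f = f"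
  then show "homogeneous d f"
    unfolding homogeneous_def by (metis coeff_hcomp)
qed

lemma homogeneous_hcomp [simp]: "homogeneous d (hcomp d f)"
  by (auto simp: homogeneous_def coeff_hcomp)

lemma hcomp_add: "hcomp d (f + g) = hcomp d f + hcomp d g"
  by (intro bpoly_eqI) (auto simp: coeff_hcomp)

lemma homogeneous_0 [simp]: "homogeneous d 0"
  by (auto simp: homogeneous_def)

lemma homogeneous_add: "homogeneous d f \<Longrightarrow> homogeneous d g \<Longrightarrow> homogeneous d (f + g)"
  unfolding homogeneous_iff_hcomp by (simp add: hcomp_add)

lemma homogeneous_uminus: "homogeneous d f \<Longrightarrow> homogeneous d (- f)"
  by (auto simp: homogeneous_def)

lemma homogeneous_diff: "homogeneous d f \<Longrightarrow> homogeneous d g \<Longrightarrow> homogeneous d (f - g)"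
  using homogeneous_add[of d f "- g"] homogeneous_uminus[of d g] by simp

lemma coeff_coeff_mult:
  "coeff (coeff (f * g) j) i =
    (\<Sum>l\<le>j. \<Sum>k\<le>i. coeff (coeff f l) k * coeff (coeff g (j - l)) (i - k))"
  by (simp add: coeff_mult coeff_sum)

text \<open>A coefficient of \<open>f * g\<close> in total degree \<open>d\<close> pairs
  coefficients of \<open>f\<close> in degree \<open>m\<close> only with coefficients of
  \<open>g\<close> in degree \<open>d - m\<close>. The case split accounts for truncated
  subtraction.\<close>

lemma hcomp_mult:
  assumes "homogeneous m f"
  shows "hcomp d (f * g) = (if m \<le> d then f * hcomp (d - m) g else 0)"
proof (rule bpoly_eqI)
  fix i j
  have "coeff (coeff f l) k * coeff (coeff g (j - l)) (i - k) =
      (if m \<le> d then coeff (coeff f l) k * coeff (coeff (hcomp (d - m) g) (j - l)) (i - k) else 0)"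
    if "i + j = d" "l \<le> j" "k \<le> i" for l k
    using that homogeneousD[OF assms, of k l]
    by (cases "k + l = m") (auto simp: coeff_hcomp)
  moreover have "coeff (coeff f l) k * coeff (coeff (hcomp (d - m) g) (j - l)) (i - k) = 0"
    if "i + j \<noteq> d" "l \<le> j" "k \<le> i" "m \<le> d" for l k
    using that homogeneousD[OF assms, of k l]
    by (cases "k + l = m") (auto simp: coeff_hcomp)
  ultimately show "coeff (coeff (hcomp d (f * g)) j) i =
      coeff (coeff (if m \<le> d then f * hcomp (d - m) g else 0) j) i"
    unfolding coeff_hcomp[of d] by (auto simp: coeff_coeff_mult simp del: mult_eq_0_iff intro!: sum.neutral sum.cong)
qed

lemma homogeneous_mult: "homogeneous m f \<Longrightarrow> homogeneous n g \<Longrightarrow> homogeneous (m + n) (f * g)"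
  using hcomp_mult[of m f "m + n" g] by (simp add: homogeneous_iff_hcomp)

lemma homogeneous_1 [simp]: "homogeneous 0 1"
  by (auto simp: homogeneous_def coeff_1 one_pCons split: nat.splits if_splits simp: coeff_pCons)

lemma homogeneous_power: "homogeneous m f \<Longrightarrow> homogeneous (n * m) (f ^ n)"
  by (induction n) (auto intro: homogeneous_mult)

text \<open>The product equals its own component of degree \<open>d\<close>, which is
  \<open>f\<close> times a component of \<open>g\<close> or zero. Cancelling \<open>f\<close>
  identifies that component with \<open>g\<close>, and \<open>g \<noteq> 0\<close> rules out
  \<open>m > d\<close>.\<close>

lemma homogeneous_mult_cancel:
  assumes "homogeneous m f" "f \<noteq> 0" "homogeneous d (f * g)" "g \<noteq> 0"
  shows "m \<le> d" "homogeneous (d - m) g"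
proof -
  have *: "(if m \<le> d then f * hcomp (d - m) g else 0) = f * g"
    using assms(3) hcomp_mult[OF assms(1), of d g] by (simp add: homogeneous_iff_hcomp)
  then show "m \<le> d"
    using assms by (auto split: if_splits)
  then show "homogeneous (d - m) g"
    using * assms by (simp add: homogeneous_iff_hcomp)
qed

abbreviation const :: "'k::field \<Rightarrow> 'k bpoly" where "const c \<equiv> [:[:c:]:]"

lemma homogeneous_const [simp]: "homogeneous 0 (const c)"
  by (auto simp: homogeneous_def coeff_pCons split: nat.splits)

lemma homogeneous_const_mult: "homogeneous d f \<Longrightarrow> homogeneous d (const c * f)"
  using homogeneous_mult[OF homogeneous_const] by simp

lemma homogeneous_0_const: "homogeneous 0 f \<Longrightarrow> f = const (coeff (coeff f 0) 0)"
  by (intro bpoly_eqI) (auto simp: homogeneous_def coeff_pCons split: nat.splits)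


subsection \<open>The three linear forms\<close>

lemma lin_form_simps:
  "lin_form 1 = [:[:0, 1:]:]" "lin_form 2 = [:0, 1:]" "lin_form 3 = [:[:0, 1:], 1:]"
  by (auto simp: lin_form_def var_x_def var_y_def)

lemma homogeneous_lin_form [simp]: "homogeneous 1 (lin_form i)"
proof -
  have "homogeneous 1 var_x" "homogeneous 1 var_y"
    by (auto simp: homogeneous_def var_x_def var_y_def coeff_pCons split: nat.splits)
  then show ?thesis
    by (auto simp: lin_form_def intro: homogeneous_add)
qed

text \<open>Divisibility by this polynomial is vanishing at \<open>- a\<close>, and evaluation is
  multiplicative with values in an integral domain.\<close>

lemma prime_elem_monic_linear: "prime_elem [:a, 1 :: 'a::idom:]"
proof (rule prime_elemI)
  fix f g assume "[:a, 1:] dvd f * g"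
  then show "[:a, 1:] dvd f \<or> [:a, 1:] dvd g"
    using poly_eq_0_iff_dvd[of _ "- a"] by (metis minus_minus mult_eq_0_iff poly_mult)
qed (auto simp: is_unit_poly_iff)

text \<open>The form x is prime in the inner ring and stays prime after adjoining y; the other two
  forms are monic linear in y.\<close>

lemma prime_elem_lin_form [simp]: "prime_elem (lin_form i :: 'k::field bpoly)"
proof -
  have "prime_elem [:[:0, 1:] :: 'k poly:]"
    by (intro lift_prime_elem_poly prime_elem_monic_linear)
  then show ?thesis
    using exhaust_3[of i] by (auto simp: lin_form_simps prime_elem_monic_linear)
qed

lemma lin_form_nonzero [simp]: "lin_form i \<noteq> 0"
  using prime_elem_lin_form[of i] by (metis not_prime_elem_zero)

text \<open>Restriction of a homogeneous polynomial to the line \<open>ker \<alpha>\<^sub>i\<close>, as the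
  value at a spanning vector of that line.\<close>

definition line_val :: "3 \<Rightarrow> 'k::field bpoly \<Rightarrow> 'k" where
  "line_val i f = (if i = 1 then poly (poly f [:1:]) 0
     else if i = 2 then poly (poly f [:0:]) 1 else poly (poly f [:-1:]) 1)"

lemma line_val_simps:
  "line_val 1 f = poly (poly f [:1:]) 0" "line_val 2 f = poly (poly f [:0:]) 1"
  "line_val 3 f = poly (poly f [:-1:]) 1"
  by (simp_all add: line_val_def)

lemma line_val_hom:
  "line_val i (f + g) = line_val i f + line_val i g"
  "line_val i (f - g) = line_val i f - line_val i g"
  "line_val i (f * g) = line_val i f * line_val i g"
  "line_val i (f ^ n) = line_val i f ^ n"
  "line_val i (smult [:c:] f) = c * line_val i f"
  by (simp_all add: line_val_def)

lemma poly_sum_upto: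
  fixes f :: "'a::comm_ring_1 poly"
  assumes "degree f \<le> n"
  shows "poly f c = (\<Sum>i\<le>n. coeff f i * c ^ i)"
  unfolding poly_altdef by (rule sum.mono_neutral_left) (use assms in \<open>auto simp: coeff_eq_0\<close>)

text \<open>Substituting y = s x in a form of degree d gives f(1, s) x^d, so vanishing on that line
  is decided by one scalar.\<close>

lemma poly_homogeneous:
  assumes "homogeneous d f"
  shows "poly f (smult s [:0, 1:]) = monom (poly (poly f [:s:]) 1) d"
proof -
  have c: "coeff f j = monom (coeff (coeff f j) (d - j)) (d - j)" if "j \<le> d" for j
    using that by (intro poly_eqI) (auto intro!: homogeneousD[OF assms])
  have z: "coeff f j = 0" if "j > d" for j
    using that by (intro poly_eqI) (auto intro!: homogeneousD[OF assms])
  have deg: "degree f \<le> d"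
    by (rule degree_le) (simp add: z)
  have "poly f (smult s [:0, 1:]) = (\<Sum>j\<le>d. coeff f j * smult s [:0, 1:] ^ j)"
    using deg by (rule poly_sum_upto)
  also have "\<dots> = (\<Sum>j\<le>d. monom (coeff (coeff f j) (d - j) * s ^ j) d)"
  proof (rule sum.cong[OF refl])
    fix j assume "j \<in> {..d}"
    then have "j \<le> d" by simp
    have "coeff f j * smult s [:0, 1:] ^ j =
        monom (coeff (coeff f j) (d - j)) (d - j) * monom (s ^ j) j"
      by (subst c[OF \<open>j \<le> d\<close>]) (simp only: smult_power monom_altdef)
    then show "coeff f j * smult s [:0, 1:] ^ j = monom (coeff (coeff f j) (d - j) * s ^ j) d"
      using \<open>j \<le> d\<close> by (simp add: mult_monom)
  qed
  also have "\<dots> = monom (\<Sum>j\<le>d. coeff (coeff f j) (d - j) * s ^ j) d"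
    by (simp add: monom_sum)
  also have "(\<Sum>j\<le>d. coeff (coeff f j) (d - j) * s ^ j) = poly (poly f [:s:]) 1"
  proof -
    have "poly f [:s:] = (\<Sum>j\<le>d. coeff f j * [:s:] ^ j)"
      using deg by (rule poly_sum_upto)
    then have "poly (poly f [:s:]) 1 = (\<Sum>j\<le>d. poly (coeff f j) 1 * s ^ j)"
      by (simp add: poly_sum)
    also have "\<dots> = (\<Sum>j\<le>d. coeff (coeff f j) (d - j) * s ^ j)"
      by (intro sum.cong refl) (subst c, auto simp: poly_monom)
    finally show ?thesis by simp
  qed
  finally show ?thesis .
qed

lemma poly_homogeneous_eq_0_iff:
  assumes "homogeneous d f"
  shows "poly f (smult s [:0, 1:]) = 0 \<longleftrightarrow> poly (poly f [:s:]) 1 = 0"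
  unfolding poly_homogeneous[OF assms] by (rule monom_eq_0_iff)

lemma lin_form_dvd_iff:
  assumes "homogeneous d f"
  shows "lin_form i dvd f \<longleftrightarrow> line_val i f = 0"
proof -
  consider "i = 1" | "i = 2" | "i = 3" using exhaust_3 by blast
  then show ?thesis
  proof cases
    case 1
    \<comment> \<open>At x = 0 a form of degree \<open>d\<close> reduces to a multiple of y^d, whose
      value at (0, 1) is its coefficient.\<close>
    have z: "poly (coeff f j) 0 = (if j = d then coeff (coeff f d) 0 else 0)" for j
      by (auto simp: poly_0_coeff_0 intro!: homogeneousD[OF assms])
    have "poly (poly f [:1:]) 0 = (\<Sum>j\<le>max d (degree f). poly (coeff f j) 0)"
      by (subst poly_sum_upto[of _ "max d (degree f)"]) (auto simp: poly_sum)
    also have "\<dots> = coeff (coeff f d) 0"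
      by (simp add: z)
    finally have "line_val i f = coeff (coeff f d) 0"
      using 1 by (simp add: line_val_simps)
    moreover have "lin_form i dvd f \<longleftrightarrow> (\<forall>j. poly (coeff f j) 0 = 0)"
      using 1 poly_eq_0_iff_dvd[of _ "0 :: 'a"] by (simp add: lin_form_simps const_poly_dvd_iff)
    ultimately show ?thesis by (auto simp: z)
  next
    case 2
    then show ?thesis
      using poly_homogeneous_eq_0_iff[OF assms, of 0] poly_eq_0_iff_dvd[of f 0]
      by (simp add: lin_form_simps line_val_simps)
  next
    case 3
    then show ?thesis
      using poly_homogeneous_eq_0_iff[OF assms, of "-1"] poly_eq_0_iff_dvd[of f "- [:0, 1:]"]
      by (simp add: lin_form_simps line_val_simps)
  qed
qed

lemma line_val_lin_form_nonzero:
  obtains j where "line_val i (lin_form j :: 'k::field bpoly) \<noteq> 0"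
proof -
  have "line_val i (lin_form (if i = 1 then 2 else 1) :: 'k bpoly) \<noteq> 0"
    using exhaust_3[of i] by (auto simp: lin_form_simps line_val_simps)
  then show ?thesis using that by blast
qed

lemma lin_form_not_dvd:
  assumes "i \<noteq> j"
  shows "\<not> lin_form i dvd (lin_form j :: 'k::field bpoly)"
proof -
  have "line_val i (lin_form j :: 'k bpoly) \<noteq> 0"
    using assms exhaust_3[of i] exhaust_3[of j] by (auto simp: lin_form_simps line_val_simps)
  then show ?thesis
    by (simp add: lin_form_dvd_iff[OF homogeneous_lin_form])
qed

text \<open>Modulo \<open>lin_form i\<close> a form of given degree is determined by its value at
  one point of the line, so matching a single scalar suffices.\<close>

lemma reduce_mod_lin_form:
  fixes f g :: "'k::field bpoly"
  assumes f: "homogeneous d f" and g: "homogeneous (d + e) g" and "\<not> lin_form i dvd f"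
  obtains s where "homogeneous e s" "lin_form i dvd g - s * f"
proof -
  obtain j where j: "line_val i (lin_form j :: 'k bpoly) \<noteq> 0"
    by (rule line_val_lin_form_nonzero)
  \<comment> \<open>A power of a linear form that does not vanish on the line supplies the degree
    \<open>e\<close>; the constant makes \<open>s * f\<close> and \<open>g\<close> agree
    there.\<close>
  define s where
    "s = const (line_val i g / (line_val i f * line_val i (lin_form j :: 'k bpoly) ^ e)) * lin_form j ^ e"
  have s: "homogeneous e s"
    unfolding s_def using homogeneous_power[OF homogeneous_lin_form, of e j]
    by (intro homogeneous_const_mult) simp
  have "homogeneous (d + e) (g - s * f)"
    using homogeneous_mult[OF s f] g by (intro homogeneous_diff) (simp_all add: add.commute)
  moreover have "line_val i (g - s * f) = 0"
    using assms(3) j by (simp add: s_def line_val_hom lin_form_dvd_iff[OF f])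
  ultimately have "lin_form i dvd g - s * f"
    by (simp add: lin_form_dvd_iff)
  then show ?thesis using s that by blast
qed

lemma power_dvd_cancel:
  fixes q :: "'a::algebraic_semidom"
  assumes "prime_elem q" "\<not> q dvd a" "q ^ n dvd a * b"
  shows "q ^ n dvd b"
proof -
  from prime_elem_power_dvd_prod[OF assms(3) assms(1)]
  obtain i j where "i + j = n" "q ^ i dvd a" "q ^ j dvd b" by blast
  moreover have "i = 0"
    using \<open>q ^ i dvd a\<close> assms(2) dvd_power[of i q] by (meson dvd_trans gr0I)
  ultimately show ?thesis by simp
qed

lemma homogeneous_power_dvd:
  assumes "homogeneous d f" "f \<noteq> 0" "lin_form i ^ n dvd f"
  shows "n \<le> d"
proof -
  obtain g where g: "f = lin_form i ^ n * g" using assms(3) by (auto elim: dvdE)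
  show ?thesis
    using homogeneous_mult_cancel(1)[of n "lin_form i ^ n" d g] assms g
      homogeneous_power[OF homogeneous_lin_form, of n i] by auto
qed


declare One_nat_def [simp del] \<comment> \<open>keeps \<open>axis i 1\<close> from becoming \<open>axis i (Suc 0)\<close>\<close>

subsection \<open>Homogeneous bases of logarithmic derivations\<close>

abbreviation lin_val :: "3 \<Rightarrow> 'k::field der \<Rightarrow> 'k bpoly" where
  "lin_val i \<theta> \<equiv> der_apply \<theta> (lin_form i)"

lemma lin_val_simps:
  "lin_val 1 \<theta> = fst \<theta>" "lin_val 2 \<theta> = snd \<theta>" "lin_val 3 \<theta> = fst \<theta> + snd \<theta>"
proof -
  have "deriv_x [:[:0, 1:] :: 'a poly:] = 1" "deriv_x [:0, 1 :: 'a poly:] = 0"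
    "deriv_x [:[:0, 1:], 1 :: 'a poly:] = 1"
    "deriv_y [:[:0, 1:] :: 'a poly:] = 0" "deriv_y [:0, 1 :: 'a poly:] = 1"
    "deriv_y [:[:0, 1:], 1 :: 'a poly:] = 1"
    by (simp_all add: deriv_x_def deriv_y_def map_poly_pCons pderiv_pCons one_pCons)
  then show "lin_val 1 \<theta> = fst \<theta>" "lin_val 2 \<theta> = snd \<theta>" "lin_val 3 \<theta> = fst \<theta> + snd \<theta>"
    by (simp_all add: lin_form_simps der_apply_def)
qed

lemma lin_val_hom:
  "lin_val i (\<theta> + \<phi>) = lin_val i \<theta> + lin_val i \<phi>"
  "lin_val i (\<theta> - \<phi>) = lin_val i \<theta> - lin_val i \<phi>"
  "lin_val i (der_scale a \<theta>) = a * lin_val i \<theta>"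
  "lin_val i 0 = 0"
  by (simp_all add: der_apply_def der_scale_def algebra_simps)

lemma der_eq_0I:
  assumes "lin_val i \<theta> = 0" "lin_val j \<theta> = 0" "i \<noteq> j"
  shows "\<theta> = 0"
  using assms exhaust_3[of i] exhaust_3[of j]
  by (auto simp: lin_val_simps prod_eq_iff)

lemma der_eq_iff: "\<theta> = \<phi> \<longleftrightarrow> (\<forall>i. lin_val i \<theta> = lin_val i \<phi>)"
  by (auto simp: forall_3 lin_val_simps prod_eq_iff)

lemma der_homogeneous_iff: "der_homogeneous d \<theta> \<longleftrightarrow> (\<forall>i. homogeneous d (lin_val i \<theta>))"
  by (auto simp: der_homogeneous_def forall_3 lin_val_simps intro: homogeneous_add)

lemma der_homogeneous_lin_form_scale:
  assumes "der_homogeneous d \<theta>"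
  shows "der_homogeneous (Suc d) (der_scale (lin_form i) \<theta>)"
  unfolding der_homogeneous_iff lin_val_hom
proof
  fix j
  show "homogeneous (Suc d) (lin_form i * lin_val j \<theta>)"
    using assms homogeneous_mult[OF homogeneous_lin_form, of d "lin_val j \<theta>" i]
    by (simp add: der_homogeneous_iff plus_1_eq_Suc)
qed

lemma log_der_iff: "\<theta> \<in> log_der \<mu> \<longleftrightarrow> (\<forall>i. lin_form i ^ (\<mu> $ i) dvd lin_val i \<theta>)"
  by (simp add: log_der_def)

lemma log_der_closed:
  "\<theta> \<in> log_der \<mu> \<Longrightarrow> \<phi> \<in> log_der \<mu> \<Longrightarrow> \<theta> + \<phi> \<in> log_der \<mu>"
  "\<theta> \<in> log_der \<mu> \<Longrightarrow> \<phi> \<in> log_der \<mu> \<Longrightarrow> \<theta> - \<phi> \<in> log_der \<mu>"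
  "\<theta> \<in> log_der \<mu> \<Longrightarrow> der_scale a \<theta> \<in> log_der \<mu>"
  by (auto simp: log_der_iff lin_val_hom)

lemma log_der_add_axis_iff:
  "\<theta> \<in> log_der (\<mu> + axis i 1) \<longleftrightarrow>
    \<theta> \<in> log_der \<mu> \<and> lin_form i ^ Suc (\<mu> $ i) dvd lin_val i \<theta>"
proof -
  have "lin_form i ^ (\<mu> $ i) dvd lin_val i \<theta>" if "lin_form i ^ Suc (\<mu> $ i) dvd lin_val i \<theta>"
    using that by (metis dvd_mult_right power_Suc)
  moreover have "(\<mu> + axis i 1) $ j = (if j = i then Suc (\<mu> $ i) else \<mu> $ j)" for j
    by (simp add: axis_def)
  ultimately show ?thesis
    unfolding log_der_iff by metis
qed

lemma lin_form_scale_in_log_der: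
  assumes "\<theta> \<in> log_der \<mu>"
  shows "der_scale (lin_form i) \<theta> \<in> log_der (\<mu> + axis i 1)"
proof -
  have "lin_form i ^ Suc (\<mu> $ i) dvd lin_form i * lin_val i \<theta>"
    using assms unfolding log_der_iff by simp
  then show ?thesis
    using assms by (simp only: log_der_add_axis_iff log_der_closed lin_val_hom)
qed

lemma lin_form_scale_in_log_derD:
  assumes "der_scale (lin_form i) \<theta> \<in> log_der (\<mu> + axis i 1)"
  shows "\<theta> \<in> log_der \<mu>"
  unfolding log_der_iff
proof
  fix j
  have *: "lin_form j ^ ((\<mu> + axis i 1) $ j) dvd lin_form i * lin_val j \<theta>"
    using assms by (simp add: log_der_iff lin_val_hom)
  show "lin_form j ^ (\<mu> $ j) dvd lin_val j \<theta>"
  proof (cases "j = i")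
    case True
    then show ?thesis using * by (simp add: axis_def flip: Suc_eq_plus1)
  next
    case False
    then show ?thesis
      using power_dvd_cancel[OF prime_elem_lin_form lin_form_not_dvd[OF False]] * by (simp add: axis_def)
  qed
qed

text \<open>Working form of \<open>exponents\<close>, with independence and spanning written in
  explicit coefficients; \<open>exponents_iff\<close> relates the two.\<close>

definition hom_basis :: "nat ^ 3 \<Rightarrow> 'k::field der \<Rightarrow> 'k der \<Rightarrow> nat \<Rightarrow> nat \<Rightarrow> bool" where
  "hom_basis \<mu> \<theta>1 \<theta>2 d1 d2 \<longleftrightarrow> \<theta>1 \<in> log_der \<mu> \<and> \<theta>2 \<in> log_der \<mu> \<and>
    (\<forall>u v. der_scale u \<theta>1 + der_scale v \<theta>2 = 0 \<longrightarrow> u = 0 \<and> v = 0) \<and>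
    (\<forall>\<theta>\<in>log_der \<mu>. \<exists>u v. \<theta> = der_scale u \<theta>1 + der_scale v \<theta>2) \<and>
    der_homogeneous d1 \<theta>1 \<and> der_homogeneous d2 \<theta>2"

lemma hom_basisI:
  assumes "\<theta>1 \<in> log_der \<mu>" "\<theta>2 \<in> log_der \<mu>"
    "\<And>u v. der_scale u \<theta>1 + der_scale v \<theta>2 = 0 \<Longrightarrow> u = 0 \<and> v = 0"
    "\<And>\<theta>. \<theta> \<in> log_der \<mu> \<Longrightarrow> \<exists>u v. \<theta> = der_scale u \<theta>1 + der_scale v \<theta>2"
    "der_homogeneous d1 \<theta>1" "der_homogeneous d2 \<theta>2"
  shows "hom_basis \<mu> \<theta>1 \<theta>2 d1 d2"
  using assms by (auto simp: hom_basis_def)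

lemma hom_basisD:
  assumes "hom_basis \<mu> \<theta>1 \<theta>2 d1 d2"
  shows "\<theta>1 \<in> log_der \<mu>" "\<theta>2 \<in> log_der \<mu>"
    "\<And>u v. der_scale u \<theta>1 + der_scale v \<theta>2 = 0 \<Longrightarrow> u = 0 \<and> v = 0"
    "\<And>\<theta>. \<theta> \<in> log_der \<mu> \<Longrightarrow> \<exists>u v. \<theta> = der_scale u \<theta>1 + der_scale v \<theta>2"
    "der_homogeneous d1 \<theta>1" "der_homogeneous d2 \<theta>2"
  using assms by (auto simp: hom_basis_def)

lemma hom_basis_swap: "hom_basis \<mu> \<theta>1 \<theta>2 d1 d2 \<Longrightarrow> hom_basis \<mu> \<theta>2 \<theta>1 d2 d1"
  unfolding hom_basis_def by (metis add.commute)

lemma hom_basis_nonzero: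
  assumes "hom_basis \<mu> \<theta>1 \<theta>2 d1 d2"
  shows "\<theta>1 \<noteq> 0"
  using hom_basisD(3)[OF assms, of 1 0] by (auto simp: der_scale_def zero_prod_def)

text \<open>Shows later that the two elements of a basis cannot both satisfy the stricter condition
  at \<open>lin_form i\<close>.\<close>

lemma log_der_not_subset_add_axis:
  fixes K :: "'k::field itself"
  obtains \<theta> :: "'k der" where "\<theta> \<in> log_der \<mu>" "\<not> lin_form i ^ Suc (\<mu> $ i) dvd lin_val i \<theta>"
proof -
  have no: "\<not> lin_form i ^ Suc m dvd lin_form i ^ m * (lin_form j ^ n :: 'k bpoly)"
    if "i \<noteq> j" for i j m n
  proof
    assume "lin_form i ^ Suc m dvd lin_form i ^ m * (lin_form j ^ n :: 'k bpoly)"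
    then have "lin_form i dvd (lin_form j ^ n :: 'k bpoly)" by simp
    then show False
      using lin_form_not_dvd[OF that] prime_elem_dvd_power[OF prime_elem_lin_form] by blast
  qed
  \<comment> \<open>One coordinate is zero, so one condition is vacuous. The other two constrain the
    same polynomial up to order, which is chosen with exact order \<open>\<mu> $ i\<close> at
    \<open>lin_form i\<close>.\<close>
  define \<theta> :: "'k der" where "\<theta> = (if i = 1 then (lin_form 1 ^ (\<mu> $ 1) * lin_form 3 ^ (\<mu> $ 3), 0)
    else (0, lin_form 2 ^ (\<mu> $ 2) * lin_form 3 ^ (\<mu> $ 3)))"
  have "\<theta> \<in> log_der \<mu>"
    by (simp add: log_der_iff forall_3 lin_val_simps \<theta>_def)
  moreover have "\<not> lin_form i ^ Suc (\<mu> $ i) dvd lin_val i \<theta>"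
    using exhaust_3[of i] no[of 1 3] no[of 2 3] no[of 3 2]
    by (auto simp: lin_val_simps \<theta>_def mult.commute simp del: power_Suc)
  ultimately show ?thesis using that by blast
qed

text \<open>After removing \<open>lin_form i ^ (\<mu> $ i)\<close>, membership of a combination in
  the smaller module is one congruence on its coefficients modulo a prime. Either the first
  generator already satisfies it and the second is multiplied by \<open>lin_form i\<close>, or the
  second is corrected by a multiple of the first and the first is multiplied.\<close>

lemma hom_basis_add_axis:
  fixes \<theta>1 \<theta>2 :: "'k::field der"
  assumes B: "hom_basis \<mu> \<theta>1 \<theta>2 d1 d2" and "d1 \<le> d2"
  obtains \<phi>1 \<phi>2 :: "'k der" and e1 e2 where
    "hom_basis (\<mu> + axis i 1) \<phi>1 \<phi>2 e1 e2" "e1 + e2 = Suc (d1 + d2)"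
proof -
  let ?a = "lin_form i :: 'k bpoly" and ?n = "\<mu> $ i"
  note D = hom_basisD[OF B]
  obtain g1 g2 where g: "lin_val i \<theta>1 = ?a ^ ?n * g1" "lin_val i \<theta>2 = ?a ^ ?n * g2"
    using D(1,2) unfolding log_der_iff by (meson dvdE)
  have mem: "der_scale u \<theta>1 + der_scale v \<theta>2 \<in> log_der (\<mu> + axis i 1) \<longleftrightarrow> ?a dvd u * g1 + v * g2" for u v
  proof -
    have "lin_val i (der_scale u \<theta>1 + der_scale v \<theta>2) = ?a ^ ?n * (u * g1 + v * g2)"
      by (simp add: lin_val_hom g algebra_simps)
    then show ?thesis
      using D(1,2) by (simp add: log_der_add_axis_iff log_der_closed mult.commute[of ?a])
  qed
  show ?thesis
  proof (cases "?a dvd g1")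
    case True
    have not: "\<not> ?a dvd g2"
    proof
      assume "?a dvd g2"
      obtain \<theta> :: "'k der" where \<theta>: "\<theta> \<in> log_der \<mu>" "\<not> ?a ^ Suc ?n dvd lin_val i \<theta>"
        by (rule log_der_not_subset_add_axis)
      obtain u v where "\<theta> = der_scale u \<theta>1 + der_scale v \<theta>2"
        using D(4)[OF \<theta>(1)] by blast
      then have "\<theta> \<in> log_der (\<mu> + axis i 1)"
        using mem[of u v] True \<open>?a dvd g2\<close> by simp
      then show False using \<theta>(2) by (simp add: log_der_add_axis_iff)
    qed
    have "hom_basis (\<mu> + axis i 1) \<theta>1 (der_scale ?a \<theta>2) d1 (Suc d2)"
    proof (rule hom_basisI)
      show "\<theta>1 \<in> log_der (\<mu> + axis i 1)"
        using mem[of 1 0] True by simp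
      show "der_scale ?a \<theta>2 \<in> log_der (\<mu> + axis i 1)"
        by (rule lin_form_scale_in_log_der[OF D(2)])
      show "u = 0 \<and> v = 0" if "der_scale u \<theta>1 + der_scale v (der_scale ?a \<theta>2) = 0" for u v
        using that D(3)[of u "v * ?a"] by simp
      show "\<exists>u v. \<theta> = der_scale u \<theta>1 + der_scale v (der_scale ?a \<theta>2)"
        if in_log: "\<theta> \<in> log_der (\<mu> + axis i 1)" for \<theta>
      proof -
        obtain u v where uv: "\<theta> = der_scale u \<theta>1 + der_scale v \<theta>2"
          using D(4)[of \<theta>] in_log unfolding log_der_add_axis_iff by blast
        then have "?a dvd u * g1 + v * g2" using mem in_log by blast
        then have "?a dvd v * g2" using True by (simp add: dvd_add_right_iff)
        then have "?a dvd v" using not by (simp add: prime_elem_dvd_mult_iff)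
        then obtain w where "v = w * ?a" by (auto elim: dvdE simp: mult.commute)
        then have "\<theta> = der_scale u \<theta>1 + der_scale w (der_scale ?a \<theta>2)"
          using uv by simp
        then show ?thesis by blast
      qed
      show "der_homogeneous d1 \<theta>1" by (rule D)
      show "der_homogeneous (Suc d2) (der_scale ?a \<theta>2)" by (rule der_homogeneous_lin_form_scale[OF D(6)])
    qed
    then show ?thesis by (rule that) simp
  next
    case False
    have an: "homogeneous ?n (?a ^ ?n)"
      using homogeneous_power[OF homogeneous_lin_form, of ?n i] by simp
    have hg: "homogeneous d1 (?a ^ ?n * g1)" "homogeneous d2 (?a ^ ?n * g2)"
      using D(5,6) unfolding der_homogeneous_iff g[symmetric] by blast+
    have h1: "?n \<le> d1" "homogeneous (d1 - ?n) g1"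
      using homogeneous_mult_cancel[OF an _ hg(1)] False by auto
    have h2: "homogeneous (d2 - ?n) g2"
      using homogeneous_mult_cancel(2)[OF an _ hg(2)] by (cases "g2 = 0") auto
    \<comment> \<open>The ordering of the degrees enters here: the correcting multiplier
      \<open>s\<close> has degree \<open>d2 - d1\<close>.\<close>
    have "d2 - ?n = (d1 - ?n) + (d2 - d1)" using h1 \<open>d1 \<le> d2\<close> by simp
    then obtain s where s: "homogeneous (d2 - d1) s" "?a dvd g2 - s * g1"
      using reduce_mod_lin_form[OF h1(2) _ False, of "d2 - d1" g2] h2 by auto
    let ?t = "der_scale (- s) \<theta>1 + der_scale 1 \<theta>2"
    have "hom_basis (\<mu> + axis i 1) (der_scale ?a \<theta>1) ?t (Suc d1) d2"
    proof (rule hom_basisI)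
      show "der_scale ?a \<theta>1 \<in> log_der (\<mu> + axis i 1)"
        by (rule lin_form_scale_in_log_der[OF D(1)])
      show t: "?t \<in> log_der (\<mu> + axis i 1)"
        using s(2) by (simp only: mem) simp
      show "u = 0 \<and> v = 0" if "der_scale u (der_scale ?a \<theta>1) + der_scale v ?t = 0" for u v
      proof -
        have "der_scale (u * ?a - v * s) \<theta>1 + der_scale v \<theta>2 = 0"
          using that by (simp add: der_scale_def algebra_simps)
        then show ?thesis using D(3) by fastforce
      qed
      show "\<exists>u v. \<theta> = der_scale u (der_scale ?a \<theta>1) + der_scale v ?t"
        if in_log: "\<theta> \<in> log_der (\<mu> + axis i 1)" for \<theta>
      proof -
        obtain u v where uv: "\<theta> = der_scale u \<theta>1 + der_scale v \<theta>2"
          using D(4)[of \<theta>] in_log unfolding log_der_add_axis_iff by blast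
        then have "?a dvd u * g1 + v * g2" using mem in_log by blast
        moreover have "u * g1 + v * g2 = (u + v * s) * g1 + v * (g2 - s * g1)"
          by (simp add: algebra_simps)
        ultimately have "?a dvd (u + v * s) * g1" using s(2) by (simp add: dvd_add_left_iff)
        then have "?a dvd u + v * s" using False by (simp add: prime_elem_dvd_mult_iff)
        then obtain w where "u + v * s = w * ?a" by (auto elim: dvdE simp: mult.commute)
        then have u: "u = w * ?a - v * s" by (simp add: algebra_simps)
        have "\<theta> = der_scale w (der_scale ?a \<theta>1) + der_scale v ?t"
          unfolding uv u by (simp add: der_scale_def algebra_simps)
        then show ?thesis by blast
      qed
      show "der_homogeneous (Suc d1) (der_scale ?a \<theta>1)" by (rule der_homogeneous_lin_form_scale[OF D(5)])
      show "der_homogeneous d2 ?t"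
        unfolding der_homogeneous_iff
      proof
        fix j
        have "homogeneous d1 (lin_val j \<theta>1)" "homogeneous d2 (lin_val j \<theta>2)"
          using D(5,6) by (auto simp: der_homogeneous_iff)
        then have "homogeneous d2 (- s * lin_val j \<theta>1 + 1 * lin_val j \<theta>2)"
          using homogeneous_mult[OF homogeneous_uminus[OF s(1)], of d1 "lin_val j \<theta>1"] \<open>d1 \<le> d2\<close>
          by (intro homogeneous_add) simp_all
        then show "homogeneous d2 (lin_val j ?t)"
          by (simp only: lin_val_hom)
      qed
    qed
    then show ?thesis by (rule that) simp
  qed
qed

section \<open>Existence and uniqueness of the exponents\<close>

lemma total_add: "total (\<mu> + \<nu>) = total \<mu> + total \<nu>"
  by (simp add: total_def sum.distrib)

lemma total_axis [simp]: "total (axis i 1) = 1"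
  by (simp add: total_def axis_def)

lemma multiplicity_induct [case_names 0 add_axis]:
  assumes "P 0" "\<And>\<mu> i. P \<mu> \<Longrightarrow> P (\<mu> + axis i 1)"
  shows "P (\<mu> :: nat ^ 3)"
proof (induction "total \<mu>" arbitrary: \<mu>)
  case 0
  then have "\<mu> = 0" by (simp add: total_def vec_eq_iff)
  then show ?case using assms(1) by simp
next
  case (Suc n)
  then obtain i where i: "\<mu> $ i > 0" by (force simp: total_def)
  define \<nu> where "\<nu> = (\<chi> j. if j = i then \<mu> $ j - 1 else \<mu> $ j)"
  have "\<mu> = \<nu> + axis i 1" using i by (auto simp: \<nu>_def vec_eq_iff axis_def)
  moreover from this have "total \<nu> = n" using Suc(2) by (simp add: total_add)
  ultimately show ?case using Suc(1) assms(2) by blast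
qed

text \<open>Induction starts from the two coordinate derivations in degree 0. The basis is reordered
  after each step because the exchange lemma expects increasing degrees.\<close>

lemma hom_basis_exists:
  fixes K :: "'k::field itself"
  obtains \<theta>1 \<theta>2 :: "'k der" and d1 d2 where
    "hom_basis \<mu> \<theta>1 \<theta>2 d1 d2" "d1 + d2 = total \<mu>" "d1 \<le> d2"
proof -
  have "\<exists>(\<theta>1 :: 'k der) \<theta>2 d1 d2. hom_basis \<mu> \<theta>1 \<theta>2 d1 d2 \<and> d1 + d2 = total \<mu> \<and> d1 \<le> d2"
  proof (induction \<mu> rule: multiplicity_induct)
    case 0
    have "hom_basis 0 (1, 0) (0, 1 :: 'k bpoly) 0 0"
      by (auto simp: hom_basis_def log_der_iff der_scale_def zero_prod_def der_homogeneous_def)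
    then show ?case by (force simp: total_def)
  next
    case (add_axis \<mu> i)
    then obtain \<theta>1 \<theta>2 :: "'k der" and d1 d2 where
      B: "hom_basis \<mu> \<theta>1 \<theta>2 d1 d2" "d1 + d2 = total \<mu>" "d1 \<le> d2"
      by blast
    obtain \<phi>1 \<phi>2 :: "'k der" and e1 e2 where
      C: "hom_basis (\<mu> + axis i 1) \<phi>1 \<phi>2 e1 e2" "e1 + e2 = Suc (d1 + d2)"
      using hom_basis_add_axis[OF B(1,3)] by blast
    have s: "e1 + e2 = total (\<mu> + axis i 1)" using B(2) C(2) by (simp add: total_add)
    show ?case
    proof (cases "e1 \<le> e2")
      case True
      then show ?thesis using C(1) s by blast
    next
      case False
      then show ?thesis using hom_basis_swap[OF C(1)] s by (metis add.commute nle_le)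
    qed
  qed
  then show ?thesis using that by blast
qed

text \<open>Arbitrary coefficients are replaced by their components of the right degree. A negative
  degree means a zero coefficient, which truncated subtraction alone would not express.\<close>

lemma hom_basis_homogeneous_coeffs:
  assumes B: "hom_basis \<mu> \<theta>1 \<theta>2 d1 d2" and "\<phi> \<in> log_der \<mu>" and h: "der_homogeneous e \<phi>"
  obtains u v where "\<phi> = der_scale u \<theta>1 + der_scale v \<theta>2"
    "if d1 \<le> e then homogeneous (e - d1) u else u = 0"
    "if d2 \<le> e then homogeneous (e - d2) v else v = 0"
proof -
  note D = hom_basisD[OF B]
  obtain u v where uv: "\<phi> = der_scale u \<theta>1 + der_scale v \<theta>2" using D(4) assms(2) by blast
  define u' where "u' = (if d1 \<le> e then hcomp (e - d1) u else 0)"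
  define v' where "v' = (if d2 \<le> e then hcomp (e - d2) v else 0)"
  have "lin_val i \<phi> = lin_val i (der_scale u' \<theta>1 + der_scale v' \<theta>2)" for i
  proof -
    have hi: "homogeneous d1 (lin_val i \<theta>1)" "homogeneous d2 (lin_val i \<theta>2)" "homogeneous e (lin_val i \<phi>)"
      using D(5,6) h by (auto simp: der_homogeneous_iff)
    have "lin_val i \<phi> = hcomp e (lin_val i \<theta>1 * u + lin_val i \<theta>2 * v)"
      using hi(3) unfolding homogeneous_iff_hcomp by (simp add: uv lin_val_hom mult.commute)
    also have "\<dots> = lin_val i (der_scale u' \<theta>1 + der_scale v' \<theta>2)"
      unfolding hcomp_add hcomp_mult[OF hi(1)] hcomp_mult[OF hi(2)]
      by (simp add: u'_def v'_def lin_val_hom mult.commute)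
    finally show ?thesis .
  qed
  then have "\<phi> = der_scale u' \<theta>1 + der_scale v' \<theta>2" by (simp add: der_eq_iff)
  then show ?thesis using that[of u' v'] by (simp add: u'_def v'_def)
qed

text \<open>Applied in both directions, this gives uniqueness of the exponents. A too small
  \<open>e1\<close> would make \<open>\<phi>1\<close> zero; a too small \<open>e2\<close> would make
  both new generators multiples of \<open>\<theta>1\<close>, hence dependent.\<close>

lemma hom_basis_degrees_le:
  fixes \<theta>1 \<theta>2 \<phi>1 \<phi>2 :: "'k::field der"
  assumes B: "hom_basis \<mu> \<theta>1 \<theta>2 d1 d2" and C: "hom_basis \<mu> \<phi>1 \<phi>2 e1 e2"
    and le: "d1 \<le> d2" "e1 \<le> e2"
  shows "d1 \<le> e1" "d2 \<le> e2"
proof -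
  note D = hom_basisD[OF C]
  obtain u1 v1 where 1: "\<phi>1 = der_scale u1 \<theta>1 + der_scale v1 \<theta>2"
    "if d1 \<le> e1 then homogeneous (e1 - d1) u1 else u1 = 0"
    "if d2 \<le> e1 then homogeneous (e1 - d2) v1 else v1 = 0"
    using hom_basis_homogeneous_coeffs[OF B D(1,5)] by blast
  obtain u2 v2 where 2: "\<phi>2 = der_scale u2 \<theta>1 + der_scale v2 \<theta>2"
    "if d1 \<le> e2 then homogeneous (e2 - d1) u2 else u2 = 0"
    "if d2 \<le> e2 then homogeneous (e2 - d2) v2 else v2 = 0"
    using hom_basis_homogeneous_coeffs[OF B D(2,6)] by blast
  show "d1 \<le> e1"
  proof (rule ccontr)
    assume "\<not> d1 \<le> e1"
    then have "\<phi>1 = 0" using 1 le by (simp add: der_scale_def zero_prod_def)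
    then show False using hom_basis_nonzero[OF C] by simp
  qed
  show "d2 \<le> e2"
  proof (rule ccontr)
    assume "\<not> d2 \<le> e2"
    then have "v1 = 0" "v2 = 0" using 1(3) 2(3) le by auto
    then have "der_scale u2 \<phi>1 + der_scale (- u1) \<phi>2 = 0"
      using 1(1) 2(1) by (simp add: der_scale_def zero_prod_def)
    then have "u1 = 0" using D(3) by fastforce
    then show False
      using hom_basis_nonzero[OF C] 1(1) \<open>v1 = 0\<close> by (simp add: der_scale_def zero_prod_def)
  qed
qed

text \<open>Independence of a set of two generators means independence of the pair only when they
  are distinct, so distinctness is carried along in both directions.\<close>

lemma exponents_iff:
  "exponents (K :: 'k::field itself) \<mu> d1 d2 \<longleftrightarrow> (\<exists>\<theta>1 \<theta>2 :: 'k der. hom_basis \<mu> \<theta>1 \<theta>2 d1 d2)"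
proof -
  have span: "der.span {\<theta>1, \<theta>2} = {der_scale u \<theta>1 + der_scale v \<theta>2 | u v. True}" for \<theta>1 \<theta>2 :: "'k der"
  proof -
    have "\<theta> \<in> der.span {\<theta>1, \<theta>2} \<longleftrightarrow> (\<exists>u v. \<theta> = der_scale u \<theta>1 + der_scale v \<theta>2)" for \<theta>
      by (simp only: der.span_breakdown_eq der.span_empty singleton_iff diff_diff_eq right_minus_eq)
    then show ?thesis by blast
  qed
  have indep: "\<theta>1 \<noteq> \<theta>2 \<and> der.independent {\<theta>1, \<theta>2} \<longleftrightarrow>
      (\<forall>u v. der_scale u \<theta>1 + der_scale v \<theta>2 = 0 \<longrightarrow> u = 0 \<and> v = 0)" (is "?l \<longleftrightarrow> ?r")
    for \<theta>1 \<theta>2 :: "'k der"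
  proof
    assume l: ?l
    show ?r
    proof (intro allI impI)
      fix u v assume uv: "der_scale u \<theta>1 + der_scale v \<theta>2 = 0"
      let ?w = "\<lambda>t. if t = \<theta>1 then u else v"
      have ne: "\<theta>1 \<noteq> \<theta>2" using l by blast
      then have sum: "(\<Sum>t\<in>{\<theta>1, \<theta>2}. der_scale (?w t) t) = 0" using uv by simp
      have "?w t = 0" if "t \<in> {\<theta>1, \<theta>2}" for t
        by (rule der.independentD[OF _ _ subset_refl sum that]) (use l in auto)
      from this[of \<theta>1] this[of \<theta>2] show "u = 0 \<and> v = 0" using ne by simp
    qed
  next
    assume r: ?r
    have ne: "\<theta>1 \<noteq> \<theta>2"
    proof
      assume "\<theta>1 = \<theta>2"
      then have "der_scale 1 \<theta>1 + der_scale (- 1) \<theta>2 = 0" by simp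
      then show False using r by fastforce
    qed
    have "\<forall>t\<in>{\<theta>1, \<theta>2}. w t = 0" if "(\<Sum>t\<in>{\<theta>1, \<theta>2}. der_scale (w t) t) = 0" for w
    proof -
      have "der_scale (w \<theta>1) \<theta>1 + der_scale (w \<theta>2) \<theta>2 = 0" using that ne by simp
      then show ?thesis using r by blast
    qed
    then have "der.independent {\<theta>1, \<theta>2}"
      by (subst der.dependent_finite) auto
    then show ?l using ne by blast
  qed
  show ?thesis
  proof
    assume "exponents K \<mu> d1 d2"
    then obtain \<theta>1 \<theta>2 :: "'k der" where e: "\<theta>1 \<noteq> \<theta>2" "der.independent {\<theta>1, \<theta>2}"
      "der.span {\<theta>1, \<theta>2} = log_der \<mu>" "der_homogeneous d1 \<theta>1" "der_homogeneous d2 \<theta>2"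
      unfolding exponents_def by blast
    have "hom_basis \<mu> \<theta>1 \<theta>2 d1 d2"
    proof (rule hom_basisI)
      show "\<theta>1 \<in> log_der \<mu>" "\<theta>2 \<in> log_der \<mu>"
        unfolding e(3)[symmetric] by (rule der.span_base, simp)+
      show "u = 0 \<and> v = 0" if "der_scale u \<theta>1 + der_scale v \<theta>2 = 0" for u v
        using indep[of \<theta>1 \<theta>2] e(1,2) that by blast
      show "\<exists>u v. \<theta> = der_scale u \<theta>1 + der_scale v \<theta>2" if "\<theta> \<in> log_der \<mu>" for \<theta>
        using that unfolding e(3)[symmetric] span by simp
    qed (rule e)+
    then show "\<exists>\<theta>1 \<theta>2 :: 'k der. hom_basis \<mu> \<theta>1 \<theta>2 d1 d2" by blast
  next
    assume "\<exists>\<theta>1 \<theta>2 :: 'k der. hom_basis \<mu> \<theta>1 \<theta>2 d1 d2"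
    then obtain \<theta>1 \<theta>2 :: "'k der" where B: "hom_basis \<mu> \<theta>1 \<theta>2 d1 d2" by blast
    note D = hom_basisD[OF B]
    have "der.span {\<theta>1, \<theta>2} = log_der \<mu>"
      unfolding span using D(1,2,4) by (auto intro!: log_der_closed)
    then show "exponents K \<mu> d1 d2"
      unfolding exponents_def using indep[of \<theta>1 \<theta>2] D(3,5,6) by blast
  qed
qed


subsection \<open>The least degree of a logarithmic derivation\<close>

text \<open>This is the smaller exponent (\<open>min_degree_eq\<close>); a single nonzero derivation
  already bounds it from above.\<close>

definition min_degree :: "'k::field itself \<Rightarrow> nat ^ 3 \<Rightarrow> nat" where
  "min_degree K \<mu> = (LEAST d. \<exists>\<theta> :: 'k der. \<theta> \<in> log_der \<mu> \<and> \<theta> \<noteq> 0 \<and> der_homogeneous d \<theta>)"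

lemma min_degree_le:
  "(\<theta> :: 'k::field der) \<in> log_der \<mu> \<Longrightarrow> \<theta> \<noteq> 0 \<Longrightarrow> der_homogeneous d \<theta> \<Longrightarrow> min_degree TYPE('k) \<mu> \<le> d"
  unfolding min_degree_def by (intro Least_le) blast

lemma min_degree_attained:
  obtains \<theta> :: "'k::field der" where
    "\<theta> \<in> log_der \<mu>" "\<theta> \<noteq> 0" "der_homogeneous (min_degree TYPE('k) \<mu>) \<theta>"
proof -
  obtain \<theta>1 \<theta>2 :: "'k der" and d1 d2 where B: "hom_basis \<mu> \<theta>1 \<theta>2 d1 d2"
    by (rule hom_basis_exists)
  have "\<exists>d. \<exists>\<theta> :: 'k der. \<theta> \<in> log_der \<mu> \<and> \<theta> \<noteq> 0 \<and> der_homogeneous d \<theta>"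
    using hom_basisD[OF B] hom_basis_nonzero[OF B] by blast
  from LeastI_ex[OF this] show ?thesis
    using that unfolding min_degree_def by blast
qed

lemma min_degree_eq:
  assumes B: "hom_basis \<mu> (\<theta>1 :: 'k::field der) \<theta>2 d1 d2" and "d1 \<le> d2"
  shows "min_degree TYPE('k) \<mu> = d1"
proof (rule antisym)
  show "min_degree TYPE('k) \<mu> \<le> d1"
    using hom_basisD[OF B] hom_basis_nonzero[OF B] min_degree_le by blast
  obtain \<theta> :: "'k der" where \<theta>: "\<theta> \<in> log_der \<mu>" "\<theta> \<noteq> 0"
      "der_homogeneous (min_degree TYPE('k) \<mu>) \<theta>"
    by (rule min_degree_attained)
  show "d1 \<le> min_degree TYPE('k) \<mu>"
  proof (rule ccontr)
    assume "\<not> ?thesis"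
    with hom_basis_homogeneous_coeffs[OF B \<theta>(1,3)] \<open>d1 \<le> d2\<close>
    have "\<theta> = 0" by (auto simp: der_scale_def zero_prod_def)
    then show False using \<theta>(2) by simp
  qed
qed

text \<open>The exponents add up to the total and the smaller one is \<open>min_degree\<close>;
  uniqueness of the degrees resolves the definite description. The additive form avoids truncated
  subtraction.\<close>

lemma Delta_eq:
  "Delta TYPE('k::field) \<mu> + 2 * min_degree TYPE('k) \<mu> = total \<mu>"
proof -
  obtain \<theta>1 \<theta>2 :: "'k der" and d1 d2 where
    B: "hom_basis \<mu> \<theta>1 \<theta>2 d1 d2" "d1 + d2 = total \<mu>" "d1 \<le> d2"
    by (rule hom_basis_exists)
  have uniq: "\<bar>int e1 - int e2\<bar> = int (d2 - d1)" if e: "exponents TYPE('k) \<mu> e1 e2" for e1 e2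
  proof -
    obtain \<phi>1 \<phi>2 :: "'k der" where C: "hom_basis \<mu> \<phi>1 \<phi>2 e1 e2"
      using e unfolding exponents_iff by blast
    show ?thesis
    proof (cases "e1 \<le> e2")
      case True
      then show ?thesis
        using hom_basis_degrees_le[OF B(1) C B(3) True] hom_basis_degrees_le[OF C B(1) True B(3)] by simp
    next
      case False
      then have le: "e2 \<le> e1" by simp
      show ?thesis
        using hom_basis_degrees_le[OF B(1) hom_basis_swap[OF C] B(3) le]
          hom_basis_degrees_le[OF hom_basis_swap[OF C] B(1) le B(3)] le
        by (simp add: of_nat_diff)
    qed
  qed
  have "Delta TYPE('k) \<mu> = d2 - d1"
    unfolding Delta_def
  proof (rule the_equality)
    show "\<exists>e1 e2. exponents TYPE('k) \<mu> e1 e2 \<and> int (d2 - d1) = \<bar>int e1 - int e2\<bar>"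
      using B(1) uniq exponents_iff by metis
    show "\<delta> = d2 - d1" if "\<exists>e1 e2. exponents TYPE('k) \<mu> e1 e2 \<and> int \<delta> = \<bar>int e1 - int e2\<bar>" for \<delta>
      using that uniq by force
  qed
  then show ?thesis using min_degree_eq[OF B(1,3)] B(2,3) by simp
qed

text \<open>The strict inequality puts the larger exponent above \<open>d\<close>, so the part of
  \<open>log_der \<mu>\<close> in degree \<open>d\<close> is one-dimensional.\<close>

lemma min_degree_multiple:
  assumes "(\<theta> :: 'k::field der) \<in> log_der \<mu>" "\<theta> \<noteq> 0" "der_homogeneous d \<theta>"
    and "\<phi> \<in> log_der \<mu>" "der_homogeneous d \<phi>"
    and d: "d = min_degree TYPE('k) \<mu>" "2 * d < total \<mu>"
  obtains c where "\<phi> = der_scale (const c) \<theta>"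
proof -
  obtain \<theta>1 \<theta>2 :: "'k der" and d1 d2 where
    B: "hom_basis \<mu> \<theta>1 \<theta>2 d1 d2" "d1 + d2 = total \<mu>" "d1 \<le> d2"
    by (rule hom_basis_exists)
  have "d = d1" using min_degree_eq[OF B(1,3)] d by simp
  then have "d < d2" using B(2) d(2) by simp
  have *: "\<exists>a. \<psi> = der_scale (const a) \<theta>1" if \<psi>: "\<psi> \<in> log_der \<mu>" "der_homogeneous d \<psi>" for \<psi>
  proof -
    obtain u v where uv: "\<psi> = der_scale u \<theta>1 + der_scale v \<theta>2"
      "if d1 \<le> d then homogeneous (d - d1) u else u = 0"
      "if d2 \<le> d then homogeneous (d - d2) v else v = 0"
      using hom_basis_homogeneous_coeffs[OF B(1) \<psi>] by blast
    then have "homogeneous 0 u" "v = 0" using \<open>d = d1\<close> \<open>d < d2\<close> by auto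
    then have "\<psi> = der_scale u \<theta>1" using uv(1) by simp
    then show ?thesis using homogeneous_0_const[OF \<open>homogeneous 0 u\<close>] by metis
  qed
  obtain a b where ab: "\<theta> = der_scale (const a) \<theta>1" "\<phi> = der_scale (const b) \<theta>1"
    using * assms by metis
  then have "a \<noteq> 0" using assms(2) by (auto simp: der_scale_def zero_prod_def)
  then have "\<phi> = der_scale (const (b / a)) \<theta>" using ab by (simp add: der_scale_def)
  then show ?thesis using that by blast
qed


text \<open>The lower bound comes from inclusion of the modules, the upper bound from multiplication
  by \<open>lin_form i\<close>.\<close>

lemma min_degree_add_axis:
  "min_degree TYPE('k::field) \<mu> \<le> min_degree TYPE('k) (\<mu> + axis i 1)"
  "min_degree TYPE('k::field) (\<mu> + axis i 1) \<le> Suc (min_degree TYPE('k) \<mu>)"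
proof -
  obtain \<theta> :: "'k der" where "\<theta> \<in> log_der (\<mu> + axis i 1)" "\<theta> \<noteq> 0"
      "der_homogeneous (min_degree TYPE('k) (\<mu> + axis i 1)) \<theta>"
    by (rule min_degree_attained)
  then show "min_degree TYPE('k) \<mu> \<le> min_degree TYPE('k) (\<mu> + axis i 1)"
    by (intro min_degree_le[of \<theta>]) (auto simp: log_der_add_axis_iff)
  obtain \<theta> :: "'k der" where \<theta>: "\<theta> \<in> log_der \<mu>" "\<theta> \<noteq> 0"
      "der_homogeneous (min_degree TYPE('k) \<mu>) \<theta>"
    by (rule min_degree_attained)
  show "min_degree TYPE('k) (\<mu> + axis i 1) \<le> Suc (min_degree TYPE('k) \<mu>)"
  proof (rule min_degree_le)
    show "der_scale (lin_form i) \<theta> \<in> log_der (\<mu> + axis i 1)"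
      by (rule lin_form_scale_in_log_der[OF \<theta>(1)])
    show "der_scale (lin_form i) \<theta> \<noteq> 0"
      using \<theta>(2) by (auto simp: der_scale_def prod_eq_iff)
    show "der_homogeneous (Suc (min_degree TYPE('k) \<mu>)) (der_scale (lin_form i) \<theta>)"
      by (rule der_homogeneous_lin_form_scale[OF \<theta>(3)])
  qed
qed

text \<open>A derivation of degree below \<open>\<mu> $ i\<close> would kill
  \<open>lin_form i\<close>. Its values on the other two forms would then agree up to sign and be
  divisible by both prescribed powers, whose degrees add up to \<open>\<mu> $ i\<close>.\<close>

lemma Delta_boundary:
  assumes "2 * \<mu> $ i = total \<mu>"
  shows "Delta TYPE('k::field) \<mu> = 0"
proof -
  obtain \<theta> :: "'k der" where \<theta>: "\<theta> \<in> log_der \<mu>" "\<theta> \<noteq> 0"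
      "der_homogeneous (min_degree TYPE('k) \<mu>) \<theta>"
    by (rule min_degree_attained)
  let ?d = "min_degree TYPE('k) \<mu>"
  have h: "homogeneous ?d (lin_val k \<theta>)" and dv: "lin_form k ^ (\<mu> $ k) dvd lin_val k \<theta>" for k
    using \<theta> by (auto simp: der_homogeneous_iff log_der_iff)
  have "\<mu> $ i \<le> ?d"
  proof (rule ccontr)
    assume less: "\<not> \<mu> $ i \<le> ?d"
    then have i0: "lin_val i \<theta> = 0"
      using homogeneous_power_dvd[OF h _ dv] by blast
    obtain j k where jk: "j \<noteq> k" "i \<noteq> j" "i \<noteq> k" "\<mu> $ i = \<mu> $ j + \<mu> $ k"
      "lin_val j \<theta> = lin_val k \<theta> \<or> lin_val j \<theta> = - lin_val k \<theta>"
    proof -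
      consider "i = 1" | "i = 2" | "i = 3" using exhaust_3 by blast
      then show ?thesis
      proof cases
        case 1
        then show ?thesis using assms i0 that[of 2 3]
          by (simp add: lin_val_simps total_def sum_3)
      next
        case 2
        then show ?thesis using assms i0 that[of 1 3]
          by (simp add: lin_val_simps total_def sum_3)
      next
        case 3
        then show ?thesis using assms i0 that[of 1 2]
          by (simp add: lin_val_simps total_def sum_3 add_eq_0_iff)
      qed
    qed
    have jz: "lin_val j \<theta> \<noteq> 0" using der_eq_0I[OF i0 _ jk(2)] \<theta>(2) by blast
    obtain g where g: "lin_val j \<theta> = lin_form j ^ (\<mu> $ j) * g"
      using dv by (meson dvdE)
    have "lin_form k ^ (\<mu> $ k) dvd lin_form j ^ (\<mu> $ j) * g"
      using dv[of k] jk(5) g by (metis dvd_minus_iff minus_minus)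
    moreover have "\<not> lin_form k dvd (lin_form j ^ (\<mu> $ j) :: 'k bpoly)"
      using lin_form_not_dvd[of k j] jk(1) prime_elem_dvd_power[OF prime_elem_lin_form] by blast
    ultimately have "lin_form k ^ (\<mu> $ k) dvd g"
      using power_dvd_cancel[OF prime_elem_lin_form] by blast
    moreover have hp: "homogeneous (\<mu> $ j) (lin_form j ^ (\<mu> $ j))"
      using homogeneous_power[OF homogeneous_lin_form, of "\<mu> $ j" j] by simp
    moreover have "g \<noteq> 0" using jz g by auto
    moreover note c = homogeneous_mult_cancel[OF hp _ h[of j, unfolded g] \<open>g \<noteq> 0\<close>]
    ultimately have "\<mu> $ k \<le> ?d - \<mu> $ j"
      using homogeneous_power_dvd[OF c(2)] by simp
    moreover have "\<mu> $ j \<le> ?d" using c(1) by simp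
    ultimately show False using jk(4) less by simp
  qed
  then show ?thesis using Delta_eq[where ?'k = 'k, of \<mu>] assms by simp
qed


subsection \<open>Derivatives and Frobenius\<close>

lemma pderiv_sum: "pderiv (sum f A) = (\<Sum>i\<in>A. pderiv (f i))"
  by (induction A rule: infinite_finite_induct) (simp_all add: pderiv_add)

lemma coeff_deriv_x: "coeff (deriv_x f) j = pderiv (coeff f j)"
  by (simp add: deriv_x_def coeff_map_poly)

lemma deriv_x_add: "deriv_x (f + g) = deriv_x f + deriv_x g"
  by (intro poly_eqI) (simp add: coeff_deriv_x pderiv_add)

lemma deriv_x_mult: "deriv_x (f * g) = f * deriv_x g + g * deriv_x f"
proof (rule poly_eqI)
  fix n
  have "(\<Sum>i\<le>n. coeff g i * pderiv (coeff f (n - i))) = (\<Sum>i\<le>n. coeff g (n - i) * pderiv (coeff f i))"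
    using sum.nat_diff_reindex[of "\<lambda>i. coeff g i * pderiv (coeff f (n - i))" "Suc n"]
    by (simp add: lessThan_Suc_atMost)
  then show "coeff (deriv_x (f * g)) n = coeff (f * deriv_x g + g * deriv_x f) n"
    by (simp add: coeff_deriv_x coeff_mult pderiv_sum pderiv_mult sum.distrib)
qed

text \<open>The linear factor restores the degree lost by differentiation, which also covers
  \<open>d = 0\<close>, where the derivative vanishes.\<close>

lemma homogeneous_lin_form_deriv:
  assumes "homogeneous d f"
  shows "homogeneous d (lin_form l * deriv_x f)" "homogeneous d (lin_form l * deriv_y f)"
proof -
  have "homogeneous d (lin_form l * deriv_x f) \<and> homogeneous d (lin_form l * deriv_y f)"
  proof (cases d)
    case 0
    with homogeneous_0_const[of f] assms obtain c where "f = const c" by blast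
    then have "deriv_x f = 0" "deriv_y f = 0"
      by (simp_all add: deriv_x_def deriv_y_def map_poly_pCons pderiv_pCons)
    then show ?thesis by simp
  next
    case (Suc n)
    have "homogeneous n (deriv_x f)" "homogeneous n (deriv_y f)"
      using homogeneousD[OF assms] Suc
      by (force simp: homogeneous_def coeff_deriv_x deriv_y_def coeff_pderiv of_nat_poly)+
    from this[THEN homogeneous_mult[OF homogeneous_lin_form]] show ?thesis
      by (simp add: Suc plus_1_eq_Suc)
  qed
  then show "homogeneous d (lin_form l * deriv_x f)" "homogeneous d (lin_form l * deriv_y f)"
    by blast+
qed

text \<open>Only the Leibniz rule is used, so that both partial derivatives are covered: D(q^n g) =
  q^n D g + n q^(n-1) g D q.\<close>

lemma power_dvd_derivation:
  fixes D :: "'a::comm_ring_1 \<Rightarrow> 'a"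
  assumes D: "\<And>f g. D (f * g) = f * D g + g * D f" and "q ^ n dvd f"
  shows "q ^ (n - 1) dvd D f" "D q = 0 \<Longrightarrow> q ^ n dvd D f"
proof -
  obtain g where f: "f = q ^ n * g" using assms(2) by (auto elim: dvdE)
  have "D 1 = 0" using D[of 1 1] by simp
  have *: "D (q ^ n) = of_nat n * q ^ (n - 1) * D q" for n
  proof (induction n)
    case (Suc n)
    then show ?case by (cases n) (simp_all add: D algebra_simps)
  qed (simp add: \<open>D 1 = 0\<close>)
  have "q ^ n dvd q ^ n * D g" "q ^ (n - 1) dvd q ^ n * D g"
    by (auto intro!: dvd_mult2 le_imp_power_dvd)
  moreover have "q ^ (n - 1) dvd g * (of_nat n * q ^ (n - 1) * D q)"
    by (metis dvd_mult dvd_mult2 dvd_refl)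
  ultimately show "q ^ (n - 1) dvd D f" "D q = 0 \<Longrightarrow> q ^ n dvd D f"
    unfolding f D * by (simp_all add: dvd_add)
qed

text \<open>At a strict local maximum of \<open>Delta\<close>, differentiating a logarithmic derivation of least
  degree would produce one of too small a degree, so its coefficients are constants of the
  derivation.\<close>

lemma local_max_derivation_eq_0:
  fixes \<theta> :: "'k::field der"
  assumes \<theta>: "\<theta> \<in> log_der \<mu>" "\<theta> \<noteq> 0" "der_homogeneous d \<theta>"
    and D: "\<And>f g. D (f + g) = D f + D g" "\<And>f g. D (f * g) = f * D g + g * D f"
      "\<And>f. homogeneous d f \<Longrightarrow> homogeneous d (lin_form l * D f)"
    and i: "\<mu> = \<nu> + axis i 1" "min_degree TYPE('k) \<nu> = d"
    and l: "\<mu> = \<nu>' + axis l 1" "min_degree TYPE('k) \<nu>' = d"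
    and "i \<noteq> l" and kill: "\<And>m. m \<noteq> i \<Longrightarrow> m \<noteq> l \<Longrightarrow> D (lin_form m) = 0"
    and less: "2 * d < total \<nu>"
  shows "D (fst \<theta>) = 0 \<and> D (snd \<theta>) = 0"
proof -
  define \<phi> where "\<phi> = (D (fst \<theta>), D (snd \<theta>))"
  let ?a = "lin_form l :: 'k bpoly"
  have lv: "lin_val m \<phi> = D (lin_val m \<theta>)" for m
    using exhaust_3[of m] D(1) by (auto simp: lin_val_simps \<phi>_def)
  have dv: "lin_form m ^ (\<mu> $ m) dvd lin_val m \<theta>" for m
    using \<theta>(1) by (simp add: log_der_iff)
  \<comment> \<open>Differentiation costs one order at \<open>i\<close> and at \<open>l\<close>. At
    \<open>i\<close> the loss is absorbed by passing from \<open>\<mu>\<close> to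
    \<open>\<nu>\<close>, at \<open>l\<close> by the factor \<open>?a\<close>; elsewhere the form is
    killed by \<open>D\<close> and nothing is lost.\<close>
  have "der_scale ?a \<phi> \<in> log_der \<nu>"
    unfolding log_der_iff lin_val_hom lv
  proof
    fix m
    consider "m = i" | "m = l" | "m \<noteq> i" "m \<noteq> l" by blast
    then show "lin_form m ^ (\<nu> $ m) dvd ?a * D (lin_val m \<theta>)"
    proof cases
      case 1
      then show ?thesis
        using power_dvd_derivation(1)[of D, OF D(2) dv[of m]] i(1) by (simp add: axis_def dvd_mult)
    next
      case 2
      have eq: "\<mu> $ l = \<nu> $ l" using i(1) \<open>i \<noteq> l\<close> by (simp add: axis_def)
      have "\<mu> $ l > 0" unfolding l(1) by (simp add: axis_def)
      then have "?a ^ (\<mu> $ l) = ?a * ?a ^ (\<mu> $ l - 1)" by (simp flip: power_Suc)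
      then show ?thesis
        using 2 eq power_dvd_derivation(1)[of D, OF D(2) dv[of m]] by (simp add: mult_dvd_mono)
    next
      case 3
      then show ?thesis
        using power_dvd_derivation(2)[of D, OF D(2) dv[of m] kill] i(1) by (simp add: axis_def dvd_mult)
    qed
  qed
  moreover have "der_homogeneous d (der_scale ?a \<phi>)"
    unfolding der_homogeneous_iff lin_val_hom lv
  proof
    fix m
    have h: "homogeneous d (lin_val m \<theta>)" using \<theta>(3) by (simp add: der_homogeneous_iff)
    show "homogeneous d (?a * D (lin_val m \<theta>))" by (rule D(3)[OF h])
  qed
  moreover have "\<theta> \<in> log_der \<nu>" using \<theta>(1) by (simp add: i(1) log_der_add_axis_iff)
  \<comment> \<open>Both derivations have the least degree at \<open>\<nu>\<close>, where that
    degree part is one-dimensional.\<close>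
  ultimately obtain c where c: "der_scale ?a \<phi> = der_scale (const c) \<theta>"
    using min_degree_multiple[of \<theta> \<nu> d "der_scale ?a \<phi>"] \<theta>(2,3) i(2) less by metis
  show ?thesis
  proof (cases "c = 0")
    case True
    then have "?a * D (fst \<theta>) = 0 \<and> ?a * D (snd \<theta>) = 0"
      using c by (simp add: der_scale_def \<phi>_def)
    then show ?thesis by simp
  next
    case False
    \<comment> \<open>A nonzero \<open>c\<close> would make \<open>\<theta>\<close> divisible by
      \<open>?a\<close>; the quotient lies in \<open>log_der \<nu>'\<close> and has degree
      \<open>d - 1\<close>, below the least degree there.\<close>
    define \<psi> where "\<psi> = der_scale (const (1 / c)) \<phi>"
    have "der_scale (const (1 / c)) (der_scale ?a \<phi>) = \<theta>"
      unfolding c using False by (simp add: der_scale_def flip: one_pCons)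
    then have \<psi>: "\<theta> = der_scale ?a \<psi>" by (simp add: \<psi>_def mult.commute)
    then have "\<psi> \<in> log_der \<nu>'" using \<theta>(1) lin_form_scale_in_log_derD unfolding l(1) by blast
    moreover have "\<psi> \<noteq> 0" using \<theta>(2) \<psi> by auto
    moreover have "homogeneous (d - 1) (lin_val m \<psi>) \<and> (lin_val m \<psi> \<noteq> 0 \<longrightarrow> 1 \<le> d)" for m
    proof -
      have "homogeneous d (?a * lin_val m \<psi>)"
        using \<theta>(3) unfolding der_homogeneous_iff by (simp add: \<psi> lin_val_hom)
      then show ?thesis
        using homogeneous_mult_cancel[OF homogeneous_lin_form lin_form_nonzero, of d l "lin_val m \<psi>"]
        by (cases "lin_val m \<psi> = 0") auto
    qed
    then have "der_homogeneous (d - 1) \<psi>" "1 \<le> d"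
      using \<open>\<psi> \<noteq> 0\<close> der_eq_0I[of \<psi> 1 2] by (auto simp: der_homogeneous_iff)
    ultimately show ?thesis using min_degree_le[of \<psi> \<nu>' "d - 1"] l(2) by simp
  qed
qed

section \<open>Frobenius roots of polynomials and derivations\<close>

lemma monom_sum_power_CHAR:
  fixes f :: "'a::idom poly"
  assumes "prime CHAR('a)"
  shows "f ^ CHAR('a) = (\<Sum>j\<le>degree f. monom (coeff f j ^ CHAR('a)) (CHAR('a) * j))"
proof -
  have "f ^ CHAR('a) = (\<Sum>j\<le>degree f. monom (coeff f j) j) ^ CHAR('a)"
    by (simp add: poly_as_sum_of_monoms)
  also have "\<dots> = (\<Sum>j\<le>degree f. monom (coeff f j) j ^ CHAR('a))"
    by (rule freshmans_dream_sum) (use assms in simp_all)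
  finally show ?thesis by (simp add: monom_power mult.commute)
qed

lemma coeff_power_CHAR:
  fixes f :: "'a::idom poly"
  assumes "prime CHAR('a)"
  shows "coeff (f ^ CHAR('a)) (CHAR('a) * j) = coeff f j ^ CHAR('a)"
proof -
  have "CHAR('a) > 0" using assms prime_gt_0_nat by blast
  then show ?thesis
    unfolding monom_sum_power_CHAR[OF assms] by (auto simp: coeff_sum coeff_eq_0 power_0_left)
qed

text \<open>A vanishing derivative leaves only exponents divisible by the characteristic. Roots of
  the remaining monomials add up to a root of \<open>f\<close> because Frobenius is
  additive.\<close>

lemma CHAR_root_of_pderiv_eq_0:
  fixes f :: "'a::idom poly"
  assumes "prime CHAR('a)" "pderiv f = 0" and roots: "\<And>j. \<exists>b. coeff f j = b ^ CHAR('a)"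
  obtains h where "f = h ^ CHAR('a)"
proof -
  let ?p = "CHAR('a)"
  obtain b where b: "\<And>j. coeff f j = b j ^ ?p" using roots by metis
  have z: "coeff f j = 0" if "\<not> ?p dvd j" for j
  proof -
    have "j > 0" using that by (intro gr0I) auto
    then have "of_nat j * coeff f j = 0"
      using arg_cong[OF assms(2), of "\<lambda>g. coeff g (j - 1)"] by (simp add: coeff_pderiv)
    then show ?thesis using that by (simp add: of_nat_eq_0_iff_char_dvd)
  qed
  have "f = (\<Sum>j\<le>degree f. monom (coeff f j) j)" by (simp add: poly_as_sum_of_monoms)
  also have "\<dots> = (\<Sum>j\<le>degree f. monom (if ?p dvd j then b j else 0) (j div ?p) ^ ?p)"
  proof (rule sum.cong[OF refl])
    fix j
    have "?p > 0" using assms(1) prime_gt_0_nat by blast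
    then show "monom (coeff f j) j = monom (if ?p dvd j then b j else 0) (j div ?p) ^ ?p"
      by (cases "?p dvd j") (auto simp: monom_power b[symmetric] z mult.commute)
  qed
  also have "\<dots> = (\<Sum>j\<le>degree f. monom (if ?p dvd j then b j else 0) (j div ?p)) ^ ?p"
    by (rule freshmans_dream_sum[symmetric]) (use assms(1) in simp_all)
  finally show ?thesis using that by blast
qed

text \<open>The one-variable result is applied to each coefficient in x, and the roots so obtained
  are the hypothesis for its application in y.\<close>

lemma bpoly_CHAR_root:
  fixes f :: "'k::field bpoly"
  assumes "prime CHAR('k)" and surj: "\<And>c :: 'k. \<exists>b. c = b ^ CHAR('k)"
    and "deriv_x f = 0" "deriv_y f = 0"
  obtains h where "f = h ^ CHAR('k)"
proof -
  have "\<exists>b. coeff f j = b ^ CHAR('k poly)" for j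
  proof -
    have "pderiv (coeff f j) = 0" using assms(3) by (metis coeff_0 coeff_deriv_x)
    from CHAR_root_of_pderiv_eq_0[OF assms(1) this surj] show ?thesis by auto
  qed
  then show ?thesis
    using CHAR_root_of_pderiv_eq_0[of f] assms(1,4) that by (auto simp: deriv_y_def)
qed

lemma homogeneous_CHAR_root:
  fixes f :: "'k::field bpoly"
  assumes "prime CHAR('k)" "homogeneous d (f ^ CHAR('k))"
  shows "homogeneous (d div CHAR('k)) f" "f \<noteq> 0 \<Longrightarrow> CHAR('k) dvd d"
proof -
  let ?p = "CHAR('k)"
  have p: "?p > 0" using assms(1) prime_gt_0_nat by blast
  have *: "?p * i + ?p * j = d" if "coeff (coeff f j) i \<noteq> 0" for i j
  proof -
    have "coeff (coeff (f ^ ?p) (?p * j)) (?p * i) = coeff (coeff f j) i ^ ?p"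
      using coeff_power_CHAR[of f j] coeff_power_CHAR[of "coeff f j" i] assms(1) by simp
    then show ?thesis
      using homogeneousD[OF assms(2), of "?p * i" "?p * j"] that by auto
  qed
  then show "homogeneous (d div ?p) f"
    using p unfolding homogeneous_def
    by (metis add_mult_distrib2 nonzero_mult_div_cancel_left not_gr_zero)
  assume "f \<noteq> 0"
  then obtain i j where "coeff (coeff f j) i \<noteq> 0"
    by (metis leading_coeff_0_iff)
  from *[OF this] show "?p dvd d" by (metis dvd_add dvd_triv_left)
qed

text \<open>The three forms have coefficients 0 and 1, so evaluating a derivation on them commutes
  with the additive Frobenius map.\<close>

lemma lin_val_CHAR_power:
  fixes \<theta> :: "'k::field der"
  assumes "prime CHAR('k)"
  shows "lin_val i (fst \<theta> ^ CHAR('k), snd \<theta> ^ CHAR('k)) = lin_val i \<theta> ^ CHAR('k)"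
proof -
  have "(fst \<theta> + snd \<theta>) ^ CHAR('k) = fst \<theta> ^ CHAR('k) + snd \<theta> ^ CHAR('k)"
    by (rule freshmans_dream) (use assms in simp_all)
  then show ?thesis
    using exhaust_3[of i] by (elim disjE) (simp_all add: lin_val_simps)
qed

lemma min_degree_CHAR_scale:
  assumes "prime CHAR('k::field)"
  shows "min_degree TYPE('k) (CHAR('k) *s \<mu>) \<le> CHAR('k) * min_degree TYPE('k) \<mu>"
proof -
  let ?p = "CHAR('k)"
  obtain \<theta> :: "'k der" where \<theta>: "\<theta> \<in> log_der \<mu>" "\<theta> \<noteq> 0"
      "der_homogeneous (min_degree TYPE('k) \<mu>) \<theta>"
    by (rule min_degree_attained)
  show ?thesis
  proof (rule min_degree_le)
    show "(fst \<theta> ^ ?p, snd \<theta> ^ ?p) \<in> log_der (?p *s \<mu>)"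
      unfolding log_der_iff lin_val_CHAR_power[OF assms]
    proof
      fix i
      have "lin_form i ^ (\<mu> $ i) dvd lin_val i \<theta>" using \<theta>(1) by (simp add: log_der_iff)
      from dvd_power_same[OF this, of ?p]
      show "lin_form i ^ ((?p *s \<mu>) $ i) dvd lin_val i \<theta> ^ ?p"
        by (simp add: mult.commute flip: power_mult)
    qed
    show "(fst \<theta> ^ ?p, snd \<theta> ^ ?p) \<noteq> 0"
      using \<theta>(2) by (auto simp: prod_eq_iff)
    show "der_homogeneous (?p * min_degree TYPE('k) \<mu>) (fst \<theta> ^ ?p, snd \<theta> ^ ?p)"
      using \<theta>(3) by (auto simp: der_homogeneous_def intro: homogeneous_power)
  qed
qed

lemma homogeneous_lin_form_factor:
  assumes "homogeneous d f" "f \<noteq> 0"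
  obtains k g where "f = lin_form i ^ k * g" "\<not> lin_form i dvd g"
proof -
  define k where "k = (GREATEST n. lin_form i ^ n dvd f)"
  have le: "n \<le> d" if "lin_form i ^ n dvd f" for n
    using homogeneous_power_dvd[OF assms that] .
  have "lin_form i ^ k dvd f"
    unfolding k_def by (rule GreatestI_nat[of _ 0 d, OF _ le]) simp_all
  then obtain g where g: "f = lin_form i ^ k * g" by (auto elim: dvdE)
  have "\<not> lin_form i dvd g"
  proof
    assume "lin_form i dvd g"
    then have "lin_form i ^ Suc k dvd f" unfolding g by (simp add: mult.commute[of "lin_form i"])
    then have "Suc k \<le> k"
      unfolding k_def by (rule Greatest_le_nat[of _ _ d, OF _ le])
    then show False by simp
  qed
  then show ?thesis using g that by blast
qed

text \<open>The generator of least degree at a strict local maximum is a Frobenius power, so the local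
  maximum is a multiple of the characteristic.\<close>

lemma local_max_descent:
  assumes p: "prime CHAR('k::field)" and surj: "\<And>c :: 'k. \<exists>b. c = b ^ CHAR('k)"
    and up: "\<And>i. min_degree TYPE('k) (\<mu> + axis i 1) = Suc (min_degree TYPE('k) \<mu>)"
    and down: "\<And>i. \<exists>\<nu>. \<mu> = \<nu> + axis i 1 \<and> min_degree TYPE('k) \<nu> = min_degree TYPE('k) \<mu>"
    and two: "2 \<le> Delta TYPE('k) \<mu>"
  obtains \<nu> where "\<mu> = CHAR('k) *s \<nu>"
    "CHAR('k) * min_degree TYPE('k) \<nu> \<le> min_degree TYPE('k) \<mu>"
proof -
  let ?p = "CHAR('k)" and ?d = "min_degree TYPE('k) \<mu>"
  have p0: "?p > 0" using p prime_gt_0_nat by blast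
  obtain \<theta> :: "'k der" where \<theta>: "\<theta> \<in> log_der \<mu>" "\<theta> \<noteq> 0" "der_homogeneous ?d \<theta>"
    by (rule min_degree_attained)
  obtain \<nu> where \<nu>: "\<And>i. \<mu> = \<nu> i + axis i 1" "\<And>i. min_degree TYPE('k) (\<nu> i) = ?d"
    using down by metis
  have less: "2 * ?d < total (\<nu> i)" for i
    using two Delta_eq[where ?'k = 'k, of \<mu>] \<nu>(1)[of i] by (simp add: total_add)
  \<comment> \<open>This derivative kills y, which is \<open>lin_form 2\<close>, so the two
    exceptional indices are 1 and 3; for \<open>deriv_y\<close> below they are 2 and 3.\<close>
  have dx: "deriv_x (fst \<theta>) = 0 \<and> deriv_x (snd \<theta>) = 0"
  proof (rule local_max_derivation_eq_0[OF \<theta> _ _ _ \<nu>(1,2)[of 1] \<nu>(1,2)[of 3] _ _ less])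
    show "deriv_x (lin_form m) = 0" if "m \<noteq> 1" "m \<noteq> 3" for m
      using that exhaust_3[of m]
      by (auto simp: lin_form_simps deriv_x_def map_poly_pCons pderiv_pCons pderiv_1)
    show "homogeneous ?d (lin_form 3 * deriv_x f)" if "homogeneous ?d f" for f :: "'k bpoly"
      using that by (rule homogeneous_lin_form_deriv)
  qed (auto simp: deriv_x_add deriv_x_mult)
  have dy: "deriv_y (fst \<theta>) = 0 \<and> deriv_y (snd \<theta>) = 0"
  proof (rule local_max_derivation_eq_0[OF \<theta> _ _ _ \<nu>(1,2)[of 2] \<nu>(1,2)[of 3] _ _ less])
    show "deriv_y (lin_form m) = 0" if "m \<noteq> 2" "m \<noteq> 3" for m
      using that exhaust_3[of m] by (auto simp: lin_form_simps deriv_y_def pderiv_pCons)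
    show "homogeneous ?d (lin_form 3 * deriv_y f)" if "homogeneous ?d f" for f :: "'k bpoly"
      using that by (rule homogeneous_lin_form_deriv)
  qed (auto simp: deriv_y_def pderiv_add pderiv_mult)
  obtain f where f: "fst \<theta> = f ^ ?p" using bpoly_CHAR_root[OF p surj] dx dy by blast
  obtain g where g: "snd \<theta> = g ^ ?p" using bpoly_CHAR_root[OF p surj] dx dy by blast
  define \<psi> where "\<psi> = (f, g)"
  have lv: "lin_val i \<theta> = lin_val i \<psi> ^ ?p" for i
    using lin_val_CHAR_power[OF p, of \<psi> i] by (simp add: \<psi>_def f[symmetric] g[symmetric])
  have hp: "homogeneous ?d (lin_val i \<psi> ^ ?p)" for i
    using \<theta>(3) by (simp add: der_homogeneous_iff flip: lv)
  note h = homogeneous_CHAR_root[OF p hp]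
  have "\<psi> \<noteq> 0" using \<theta>(2) p0 f g by (auto simp: \<psi>_def prod_eq_iff)
  then obtain j where "lin_val j \<psi> \<noteq> 0" using der_eq_0I[of \<psi> 1 2] by auto
  then have "?p dvd ?d" by (rule h)
  have "\<exists>k. \<mu> $ i = ?p * k \<and> lin_form i ^ k dvd lin_val i \<psi>" for i
  proof -
    let ?a = "lin_form i :: 'k bpoly"
    \<comment> \<open>Moving up in direction \<open>i\<close> raises the least degree, so
      \<open>\<theta>\<close> has order exactly \<open>\<mu> $ i\<close> at
      \<open>lin_form i\<close>. As a Frobenius power it has order \<open>?p * k\<close> there,
      where \<open>k\<close> is the order of \<open>\<psi>\<close>.\<close>
    have "\<theta> \<notin> log_der (\<mu> + axis i 1)"
      using min_degree_le[of \<theta> "\<mu> + axis i 1"] up[of i] \<theta>(2,3) by fastforce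
    then have not: "\<not> ?a ^ Suc (\<mu> $ i) dvd lin_val i \<psi> ^ ?p"
      using \<theta>(1) by (simp only: log_der_add_axis_iff lv) simp
    then have "lin_val i \<psi> \<noteq> 0" using p0 by (auto simp: power_0_left)
    then obtain k u where ku: "lin_val i \<psi> = ?a ^ k * u" "\<not> ?a dvd u"
      using homogeneous_lin_form_factor[OF h(1)] by blast
    have pow: "lin_val i \<psi> ^ ?p = ?a ^ (?p * k) * u ^ ?p"
      by (simp add: ku power_mult_distrib mult.commute flip: power_mult)
    have "\<not> ?p * k < \<mu> $ i"
    proof
      assume "?p * k < \<mu> $ i"
      then have "?a ^ Suc (?p * k) dvd lin_val i \<theta>"
        using \<theta>(1) unfolding log_der_iff by (meson Suc_leI power_le_dvd)
      then have "?a dvd u ^ ?p" unfolding lv pow by (simp add: mult.commute[of ?a])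
      then show False using ku(2) prime_elem_dvd_power[OF prime_elem_lin_form] by blast
    qed
    moreover have "\<not> \<mu> $ i < ?p * k"
    proof
      assume "\<mu> $ i < ?p * k"
      then have "?a ^ Suc (\<mu> $ i) dvd ?a ^ (?p * k)" by (intro le_imp_power_dvd) simp
      then show False using not unfolding pow by (meson dvd_mult2)
    qed
    ultimately have "\<mu> $ i = ?p * k" by simp
    then show ?thesis using ku(1) by (metis dvd_triv_left)
  qed
  then obtain k where k: "\<And>i. \<mu> $ i = ?p * k i" "\<And>i. lin_form i ^ k i dvd lin_val i \<psi>"
    by metis
  define \<kappa> :: "nat ^ 3" where "\<kappa> = (\<chi> i. k i)"
  have "\<mu> = ?p *s \<kappa>" using k(1) by (simp add: vec_eq_iff \<kappa>_def)
  moreover have "min_degree TYPE('k) \<kappa> \<le> ?d div ?p"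
    using \<open>\<psi> \<noteq> 0\<close> k(2) h(1) by (intro min_degree_le[of \<psi>]) (auto simp: log_der_iff der_homogeneous_iff \<kappa>_def)
  then have "?p * min_degree TYPE('k) \<kappa> \<le> ?d"
    using \<open>?p dvd ?d\<close> by (metis dvd_mult_div_cancel mult_le_mono2)
  ultimately show ?thesis using that by blast
qed


subsection \<open>The graph of multiplicities\<close>

text \<open>Along an edge the total grows by one and the least degree by zero or one.\<close>

lemma Delta_adjacent:
  assumes "(\<mu>, \<nu>) \<in> adjacency"
  shows "Delta TYPE('k::field) \<nu> = Suc (Delta TYPE('k) \<mu>) \<or> Delta TYPE('k) \<mu> = Suc (Delta TYPE('k) \<nu>)"
proof -
  have "Delta TYPE('k) (\<mu> + axis i 1) = Suc (Delta TYPE('k) \<mu>) \<or>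
      Delta TYPE('k) \<mu> = Suc (Delta TYPE('k) (\<mu> + axis i 1))" for \<mu> i
  proof -
    have "min_degree TYPE('k) (\<mu> + axis i 1) = min_degree TYPE('k) \<mu> \<or>
        min_degree TYPE('k) (\<mu> + axis i 1) = Suc (min_degree TYPE('k) \<mu>)"
      using min_degree_add_axis[where ?'k = 'k, of \<mu> i] by linarith
    then show ?thesis
      using Delta_eq[where ?'k = 'k, of \<mu>] Delta_eq[where ?'k = 'k, of "\<mu> + axis i 1"]
      by (elim disjE) (simp_all add: total_add)
  qed
  then show ?thesis
    using assms unfolding adjacency_def by blast
qed

lemma l1_dist_3:
  "l1_dist \<mu> \<nu> = \<bar>int (\<mu> $ 1) - int (\<nu> $ 1)\<bar> + \<bar>int (\<mu> $ 2) - int (\<nu> $ 2)\<bar> + \<bar>int (\<mu> $ 3) - int (\<nu> $ 3)\<bar>"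
  by (simp add: l1_dist_def sum_3)

lemma total_3: "total \<mu> = \<mu> $ 1 + \<mu> $ 2 + \<mu> $ 3"
  by (simp add: total_def sum_3)

lemma axis_3:
  "axis i (1::nat) $ 1 = (if i = 1 then 1 else 0)" "axis i (1::nat) $ 2 = (if i = 2 then 1 else 0)"
  "axis i (1::nat) $ 3 = (if i = 3 then 1 else 0)" for i :: 3
  by (auto simp: axis_def)

lemma l1_dist_adjacent:
  assumes "(\<mu>, \<nu>) \<in> adjacency"
  shows "l1_dist \<mu> \<nu> = 1"
proof -
  have "l1_dist \<mu> (\<mu> + axis i 1) = 1 \<and> l1_dist (\<mu> + axis i 1) \<mu> = 1" for \<mu> i
    using exhaust_3[of i] by (elim disjE) (simp_all add: l1_dist_3 axis_3)
  moreover obtain i where "\<mu> = \<nu> + axis i 1 \<or> \<nu> = \<mu> + axis i 1"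
    using assms by (auto simp: adjacency_def)
  ultimately show ?thesis by metis
qed

lemma adjacency_irrefl: "(\<mu>, \<mu>) \<notin> adjacency"
  using l1_dist_adjacent[of \<mu> \<mu>] by (auto simp: l1_dist_3)

lemma l1_dist_triangle: "l1_dist \<mu> \<kappa> \<le> l1_dist \<mu> \<nu> + l1_dist \<nu> \<kappa>"
  unfolding l1_dist_def sum.distrib[symmetric] by (rule sum_mono) linarith

lemma l1_dist_nonneg [simp]: "0 \<le> l1_dist \<mu> \<nu>"
  by (simp add: l1_dist_3)

lemma l1_dist_eq_0_iff [simp]: "l1_dist \<mu> \<nu> = 0 \<longleftrightarrow> \<mu> = \<nu>"
  by (auto simp: l1_dist_3 vec_eq_iff forall_3 add_nonneg_eq_0_iff)

lemma l1_dist_self [simp]: "l1_dist \<mu> \<mu> = 0"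
  by simp

lemma step_towards:
  assumes "\<mu> \<noteq> \<nu>"
  obtains \<mu>' where "(\<mu>, \<mu>') \<in> adjacency" "l1_dist \<mu>' \<nu> = l1_dist \<mu> \<nu> - 1"
proof -
  obtain i where i: "\<mu> $ i \<noteq> \<nu> $ i" using assms by (auto simp: vec_eq_iff)
  show ?thesis
  proof (cases "\<mu> $ i < \<nu> $ i")
    case True
    then have "l1_dist (\<mu> + axis i 1) \<nu> = l1_dist \<mu> \<nu> - 1"
      using exhaust_3[of i] by (elim disjE) (simp_all add: l1_dist_3 axis_3)
    moreover have "(\<mu>, \<mu> + axis i 1) \<in> adjacency" unfolding adjacency_def by blast
    ultimately show ?thesis using that by blast
  next
    case False
    define \<mu>' where "\<mu>' = (\<chi> j. if j = i then \<mu> $ j - 1 else \<mu> $ j)"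
    have eq: "\<mu> = \<mu>' + axis i 1"
      using False i by (simp add: vec_eq_iff \<mu>'_def axis_def)
    have "\<nu> $ i \<le> \<mu>' $ i"
      using False i by (simp add: \<mu>'_def)
    then have "l1_dist \<mu>' \<nu> = l1_dist (\<mu>' + axis i 1) \<nu> - 1"
      using exhaust_3[of i] by (elim disjE) (simp_all add: l1_dist_3 axis_3)
    then have "l1_dist \<mu>' \<nu> = l1_dist \<mu> \<nu> - 1" unfolding eq .
    moreover have "(\<mu>, \<mu>') \<in> adjacency" unfolding adjacency_def using eq by blast
    ultimately show ?thesis using that by blast
  qed
qed

lemma Delta_lipschitz:
  "int (Delta TYPE('k::field) \<nu>) \<le> int (Delta TYPE('k) \<mu>) + l1_dist \<mu> \<nu>"
proof (induction "nat (l1_dist \<mu> \<nu>)" arbitrary: \<mu>)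
  case 0
  then have "\<mu> = \<nu>" using l1_dist_nonneg[of \<mu> \<nu>] by (simp flip: l1_dist_eq_0_iff)
  then show ?case by simp
next
  case (Suc n)
  then have "\<mu> \<noteq> \<nu>" by auto
  then obtain \<mu>' where \<mu>': "(\<mu>, \<mu>') \<in> adjacency" "l1_dist \<mu>' \<nu> = l1_dist \<mu> \<nu> - 1"
    by (rule step_towards)
  have "int (Delta TYPE('k) \<nu>) \<le> int (Delta TYPE('k) \<mu>') + l1_dist \<mu>' \<nu>"
    using Suc \<mu>'(2) by (intro Suc(1)) simp
  then show ?case using Delta_adjacent[OF \<mu>'(1), where ?'k = 'k] \<mu>'(2) by auto
qed

lemma balanced_iff: "\<mu> \<in> balanced \<longleftrightarrow> (\<forall>i. 2 * \<mu> $ i \<le> total \<mu>)"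
proof -
  have "real (\<mu> $ i) \<le> real (total \<mu>) / 2 \<longleftrightarrow> 2 * \<mu> $ i \<le> total \<mu>" for i
    by linarith
  then show ?thesis by (simp add: balanced_def)
qed

text \<open>Increasing the \<open>i\<close>-th entry of a balanced multiplicity until it is half of the total reaches
  the boundary of the balanced cone, where \<open>Delta\<close> vanishes.\<close>

lemma Delta_balanced_le:
  assumes "\<mu> \<in> balanced"
  shows "Delta TYPE('k::field) \<mu> + 2 * \<mu> $ i \<le> total \<mu>"
proof -
  define g where "g = total \<mu> - 2 * \<mu> $ i"
  define \<nu> where "\<nu> = (\<chi> j. if j = i then \<mu> $ j + g else \<mu> $ j)"
  have g: "total \<mu> = g + 2 * \<mu> $ i" using assms by (simp add: g_def balanced_iff)
  have "2 * \<nu> $ i = total \<nu>"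
    using g exhaust_3[of i] by (auto simp: total_3 \<nu>_def)
  then have "Delta TYPE('k) \<nu> = 0" by (rule Delta_boundary)
  moreover have "l1_dist \<nu> \<mu> = int g"
    using exhaust_3[of i] by (auto simp: l1_dist_3 \<nu>_def)
  ultimately show ?thesis
    using Delta_lipschitz[where ?'k = 'k, of \<mu> \<nu>] g by simp
qed

text \<open>Positive \<open>Delta\<close> makes the balance inequalities strict, and one step
  changes each difference \<open>total \<mu> - 2 * \<mu> $ i\<close> by one.\<close>

lemma balanced_adjacent:
  assumes "\<mu> \<in> balanced" "0 < Delta TYPE('k::field) \<mu>" "(\<mu>, \<nu>) \<in> adjacency"
  shows "\<nu> \<in> balanced"
  unfolding balanced_iff
proof
  fix i
  have "1 + 2 * \<mu> $ i \<le> total \<mu>" using Delta_balanced_le[where ?'k = 'k, OF assms(1), of i] assms(2) by simp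
  moreover obtain j where "\<mu> = \<nu> + axis j 1 \<or> \<nu> = \<mu> + axis j 1"
    using assms(3) by (auto simp: adjacency_def)
  moreover have "axis j (1 :: nat) $ i = (if i = j then 1 else 0)" by (simp add: axis_def)
  ultimately show "2 * \<nu> $ i \<le> total \<nu>"
    by (auto simp: total_add split: if_splits)
qed

text \<open>Adding the strict balance inequalities for the two other indices shows that the entry at
  \<open>i\<close> is positive.\<close>

lemma Delta_pos_adjacent_down:
  assumes "\<mu> \<in> balanced" "0 < Delta TYPE('k::field) \<mu>"
  obtains \<nu> where "\<mu> = \<nu> + axis i 1"
proof -
  have "1 + 2 * \<mu> $ j \<le> total \<mu>" for j
    using Delta_balanced_le[where ?'k = 'k, OF assms(1), of j] assms(2) by simp
  from this[of 1] this[of 2] this[of 3] have "\<mu> $ i > 0"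
    using exhaust_3[of i] by (auto simp: total_3)
  then have "\<mu> = (\<chi> j. if j = i then \<mu> $ j - 1 else \<mu> $ j) + axis i 1"
    by (auto simp: vec_eq_iff axis_def)
  then show ?thesis by (rule that)
qed

section \<open>Scaling by the characteristic and local maxima\<close>

lemma total_scale: "total (c *s \<mu>) = c * total \<mu>"
  by (simp add: total_def sum_distrib_left)

lemma Delta_CHAR_scale:
  assumes "prime CHAR('k::field)"
  shows "CHAR('k) * Delta TYPE('k) \<mu> \<le> Delta TYPE('k) (CHAR('k) *s \<mu>)"
proof -
  have "CHAR('k) * Delta TYPE('k) \<mu> + 2 * (CHAR('k) * min_degree TYPE('k) \<mu>)
      = CHAR('k) * (Delta TYPE('k) \<mu> + 2 * min_degree TYPE('k) \<mu>)"
    by (simp add: algebra_simps)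
  also have "\<dots> = Delta TYPE('k) (CHAR('k) *s \<mu>) + 2 * min_degree TYPE('k) (CHAR('k) *s \<mu>)"
    by (simp only: Delta_eq total_scale)
  finally have "CHAR('k) * Delta TYPE('k) \<mu> + 2 * (CHAR('k) * min_degree TYPE('k) \<mu>)
      = Delta TYPE('k) (CHAR('k) *s \<mu>) + 2 * min_degree TYPE('k) (CHAR('k) *s \<mu>)" .
  then show ?thesis using min_degree_CHAR_scale[OF assms, of \<mu>] by linarith
qed

lemma Delta_CHAR_power_scale:
  assumes "prime CHAR('k::field)"
  shows "CHAR('k) ^ m * Delta TYPE('k) \<mu> \<le> Delta TYPE('k) (CHAR('k) ^ m *s \<mu>)"
proof (induction m)
  case (Suc m)
  have "CHAR('k) *s (CHAR('k) ^ m *s \<mu>) = CHAR('k) ^ Suc m *s \<mu>"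
    by (simp add: vec_eq_iff mult.assoc)
  then have "CHAR('k) * Delta TYPE('k) (CHAR('k) ^ m *s \<mu>) \<le> Delta TYPE('k) (CHAR('k) ^ Suc m *s \<mu>)"
    using Delta_CHAR_scale[OF assms, of "CHAR('k) ^ m *s \<mu>"] by simp
  moreover have "CHAR('k) ^ Suc m * Delta TYPE('k) \<mu> \<le> CHAR('k) * Delta TYPE('k) (CHAR('k) ^ m *s \<mu>)"
    using mult_le_mono2[OF Suc, of "CHAR('k)"] by (simp add: mult.assoc)
  ultimately show ?case by linarith
qed simp

definition local_max :: "'k::field itself \<Rightarrow> nat ^ 3 \<Rightarrow> bool" where
  "local_max K \<mu> \<longleftrightarrow> (\<forall>\<nu>. (\<mu>, \<nu>) \<in> adjacency \<longrightarrow> Delta K \<nu> < Delta K \<mu>)"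

text \<open>Each ascending step of \<open>Delta\<close> decreases \<open>total \<mu> - 3 * Delta \<mu>\<close>, which is nonnegative on
  the balanced cone.\<close>

lemma climb_to_local_max:
  assumes "\<mu> \<in> balanced" "0 < Delta TYPE('k::field) \<mu>"
  obtains \<eta> where "\<eta> \<in> balanced" "local_max TYPE('k) \<eta>"
    "l1_dist \<mu> \<eta> + int (Delta TYPE('k) \<mu>) \<le> int (Delta TYPE('k) \<eta>)"
proof -
  \<comment> \<open>Sum of the three inequalities \<open>Delta_balanced_le\<close>, one for each
    hyperplane.\<close>
  have bound: "3 * Delta TYPE('k) \<nu> \<le> total \<nu>" if "\<nu> \<in> balanced" for \<nu>
    using Delta_balanced_le[where ?'k = 'k, OF that, of 1] Delta_balanced_le[where ?'k = 'k, OF that, of 2]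
      Delta_balanced_le[where ?'k = 'k, OF that, of 3] by (simp add: total_3)
  have "\<exists>\<eta>. \<eta> \<in> balanced \<and> local_max TYPE('k) \<eta> \<and>
      l1_dist \<mu> \<eta> + int (Delta TYPE('k) \<mu>) \<le> int (Delta TYPE('k) \<eta>)"
    using assms
  proof (induction "total \<mu> - 3 * Delta TYPE('k) \<mu>" arbitrary: \<mu> rule: less_induct)
    case less
    show ?case
    proof (cases "local_max TYPE('k) \<mu>")
      case True
      then show ?thesis using less.prems by (intro exI[of _ \<mu>]) simp
    next
      case False
      then obtain \<nu> where \<nu>: "(\<mu>, \<nu>) \<in> adjacency" "\<not> Delta TYPE('k) \<nu> < Delta TYPE('k) \<mu>"
        by (auto simp: local_max_def)
      then have D: "Delta TYPE('k) \<nu> = Suc (Delta TYPE('k) \<mu>)"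
        using Delta_adjacent[OF \<nu>(1), where ?'k = 'k] by auto
      have b: "\<nu> \<in> balanced" using balanced_adjacent[OF less.prems \<nu>(1)] .
      have "total \<nu> \<le> Suc (total \<mu>)" using \<nu>(1) by (auto simp: adjacency_def total_add)
      then have "total \<nu> - 3 * Delta TYPE('k) \<nu> < total \<mu> - 3 * Delta TYPE('k) \<mu>"
        using bound[OF b] bound[OF less.prems(1)] D by simp
      from less.hyps[OF this b] obtain \<eta> where \<eta>: "\<eta> \<in> balanced" "local_max TYPE('k) \<eta>"
        "l1_dist \<nu> \<eta> + int (Delta TYPE('k) \<nu>) \<le> int (Delta TYPE('k) \<eta>)" using D by auto
      then show ?thesis
        using D l1_dist_triangle[of \<mu> \<eta> \<nu>] l1_dist_adjacent[OF \<nu>(1)] by (intro exI[of _ \<eta>]) auto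
    qed
  qed
  then show ?thesis using that by blast
qed

text \<open>Strong induction on \<open>Delta\<close>: as long as the value exceeds one,
  \<open>local_max_descent\<close> divides by the characteristic, and the quotient is again a
  balanced local maximum of smaller positive value.\<close>

lemma local_max_is_CHAR_power_scale:
  assumes p: "prime CHAR('k::field)" and surj: "\<And>c :: 'k. \<exists>b. c = b ^ CHAR('k)"
    and "\<mu> \<in> balanced" "local_max TYPE('k) \<mu>" "0 < Delta TYPE('k) \<mu>"
  shows "\<exists>m \<nu>. \<nu> \<in> balanced \<and> \<mu> = CHAR('k) ^ m *s \<nu> \<and> Delta TYPE('k) \<nu> = 1 \<and>
    Delta TYPE('k) \<mu> = CHAR('k) ^ m"
  using assms(3-5)
proof (induction "Delta TYPE('k) \<mu>" arbitrary: \<mu> rule: less_induct)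
  case less
  let ?p = "CHAR('k)"
  let ?\<Delta> = "Delta TYPE('k)" and ?d = "min_degree TYPE('k)"
  have p2: "2 \<le> ?p" using p prime_ge_2_nat by blast
  show ?case
  proof (cases "?\<Delta> \<mu> = 1")
    case True
    then show ?thesis using less.prems by (intro exI[of _ 0] exI[of _ \<mu>]) simp
  next
    case False
    have down: "?\<Delta> \<mu> = Suc (?\<Delta> \<nu>)" if "(\<mu>, \<nu>) \<in> adjacency" for \<nu>
      using that less.prems(2) Delta_adjacent[OF that, where ?'k = 'k] unfolding local_max_def by force
    have "?d (\<mu> + axis i 1) = Suc (?d \<mu>)" for i
    proof -
      have "?\<Delta> \<mu> = Suc (?\<Delta> (\<mu> + axis i 1))"
        by (rule down) (auto simp: adjacency_def)
      then show ?thesis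
        using Delta_eq[where ?'k = 'k, of \<mu>] Delta_eq[where ?'k = 'k, of "\<mu> + axis i 1"]
        by (simp add: total_add)
    qed
    moreover have "\<exists>\<nu>. \<mu> = \<nu> + axis i 1 \<and> ?d \<nu> = ?d \<mu>" for i
    proof -
      obtain \<nu> where \<nu>: "\<mu> = \<nu> + axis i 1"
        using Delta_pos_adjacent_down[OF less.prems(1,3)] .
      have "?\<Delta> \<mu> = Suc (?\<Delta> \<nu>)"
        by (rule down) (auto simp: adjacency_def \<nu>)
      then have "?d \<nu> = ?d \<mu>"
        using Delta_eq[where ?'k = 'k, of \<mu>] Delta_eq[where ?'k = 'k, of \<nu>] arg_cong[OF \<nu>, of total]
        by (simp add: total_add)
      then show ?thesis using \<nu> by blast
    qed
    moreover have "2 \<le> ?\<Delta> \<mu>" using False less.prems(3) by simp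
    ultimately obtain \<nu> where \<nu>: "\<mu> = ?p *s \<nu>" "?p * ?d \<nu> \<le> ?d \<mu>"
      using local_max_descent[OF p surj] by blast
    have "?\<Delta> \<mu> + 2 * ?d \<mu> = ?p * (?\<Delta> \<nu> + 2 * ?d \<nu>)"
      unfolding Delta_eq by (simp add: \<nu>(1) total_scale)
    also have "\<dots> = ?p * ?\<Delta> \<nu> + 2 * (?p * ?d \<nu>)" by (simp add: algebra_simps)
    finally have "?\<Delta> \<mu> + 2 * ?d \<mu> = ?p * ?\<Delta> \<nu> + 2 * (?p * ?d \<nu>)" .
    \<comment> \<open>One inequality comes from the descent, the other from the Frobenius
      map.\<close>
    then have D: "?\<Delta> \<mu> = ?p * ?\<Delta> \<nu>"
      using \<nu>(2) Delta_CHAR_scale[OF p, of \<nu>] \<nu>(1) by simp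
    then have pos: "0 < ?\<Delta> \<nu>" using less.prems(3) by (metis mult_0_right neq0_conv)
    have smaller: "?\<Delta> \<nu> < ?\<Delta> \<mu>" using D pos p2 by simp
    have b: "\<nu> \<in> balanced"
      using less.prems(1) p2 by (simp add: \<nu>(1) balanced_iff total_scale mult.left_commute[of 2])
    have "local_max TYPE('k) \<nu>"
      unfolding local_max_def
    proof (intro allI impI, rule ccontr)
      fix \<kappa> assume \<kappa>: "(\<nu>, \<kappa>) \<in> adjacency" "\<not> ?\<Delta> \<kappa> < ?\<Delta> \<nu>"
      then have "?\<Delta> \<kappa> = Suc (?\<Delta> \<nu>)" using Delta_adjacent[OF \<kappa>(1), where ?'k = 'k] by auto
      \<comment> \<open>A higher neighbour \<open>\<kappa>\<close> of \<open>\<nu>\<close> would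
        force a rise of at least \<open>?p\<close> on a path of length \<open>?p\<close> from
        \<open>\<mu>\<close>, but the first step away from the local maximum \<open>\<mu>\<close>
        goes down.\<close>
      then have big: "?\<Delta> \<mu> + ?p \<le> ?\<Delta> (?p *s \<kappa>)"
        using Delta_CHAR_scale[OF p, of \<kappa>] D by simp
      then have "\<mu> \<noteq> ?p *s \<kappa>" using p2 by auto
      then obtain \<mu>' where \<mu>': "(\<mu>, \<mu>') \<in> adjacency" "l1_dist \<mu>' (?p *s \<kappa>) = l1_dist \<mu> (?p *s \<kappa>) - 1"
        by (rule step_towards)
      have "l1_dist \<mu> (?p *s \<kappa>) = int ?p * l1_dist \<nu> \<kappa>"
        unfolding \<nu>(1) l1_dist_def
        by (simp add: sum_distrib_left abs_mult flip: right_diff_distrib)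
      then have "l1_dist \<mu>' (?p *s \<kappa>) = int ?p - 1"
        using l1_dist_adjacent[OF \<kappa>(1)] \<mu>'(2) by simp
      then show False
        using Delta_lipschitz[where ?'k = 'k, of "?p *s \<kappa>" \<mu>'] down[OF \<mu>'(1)] big by simp
    qed
    from less.hyps[OF smaller b this pos] obtain m \<kappa> where
      "\<kappa> \<in> balanced" "\<nu> = ?p ^ m *s \<kappa>" "?\<Delta> \<kappa> = 1" "?\<Delta> \<nu> = ?p ^ m"
      by blast
    then show ?thesis
      using \<nu>(1) D by (intro exI[of _ "Suc m"] exI[of _ \<kappa>]) (simp add: vec_eq_iff mult.assoc)
  qed
qed

section \<open>Centers of radius one\<close>

lemma component_singleton_iff:
  "{\<zeta>} \<in> components T \<longleftrightarrow> \<zeta> \<in> T \<and> (\<forall>\<nu>\<in>T. (\<zeta>, \<nu>) \<notin> adjacency)"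
proof
  assume "{\<zeta>} \<in> components T"
  then obtain \<mu> where \<mu>: "\<mu> \<in> T" "{\<zeta>} = (Restr adjacency T)\<^sup>* `` {\<mu>}"
    unfolding components_def by (auto elim!: quotientE)
  then have "\<mu> \<in> {\<zeta>}" by simp
  then have eq: "\<mu> = \<zeta>" by simp
  have "(\<zeta>, \<nu>) \<notin> adjacency" if "\<nu> \<in> T" for \<nu>
  proof
    assume "(\<zeta>, \<nu>) \<in> adjacency"
    then have "(\<zeta>, \<nu>) \<in> (Restr adjacency T)\<^sup>*" using that \<mu>(1) eq by blast
    then have "\<nu> \<in> {\<zeta>}" using \<mu>(2) eq by blast
    then show False using \<open>(\<zeta>, \<nu>) \<in> adjacency\<close> adjacency_irrefl by simp
  qed
  then show "\<zeta> \<in> T \<and> (\<forall>\<nu>\<in>T. (\<zeta>, \<nu>) \<notin> adjacency)" using \<mu>(1) eq by blast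
next
  assume r: "\<zeta> \<in> T \<and> (\<forall>\<nu>\<in>T. (\<zeta>, \<nu>) \<notin> adjacency)"
  have "\<nu> = \<zeta>" if "(\<zeta>, \<nu>) \<in> (Restr adjacency T)\<^sup>*" for \<nu>
    using that r by (auto elim: converse_rtranclE)
  then have "(Restr adjacency T)\<^sup>* `` {\<zeta>} = {\<zeta>}" by auto
  then show "{\<zeta>} \<in> components T"
    using r unfolding components_def by (metis quotientI)
qed

text \<open>A ball of radius one is a single point, so these centers are the balanced points with
  value one that are isolated in the positive set.\<close>

lemma centers_of_Delta_1_iff:
  "\<zeta> \<in> centers_of_Delta (K :: 'k::field itself) 1 \<longleftrightarrow> \<zeta> \<in> balanced \<and> Delta K \<zeta> = 1 \<and>
    (\<forall>\<nu>. (\<zeta>, \<nu>) \<in> adjacency \<longrightarrow> Delta K \<nu> = 0)"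
proof -
  have ball: "l1_ball \<zeta> 1 = {\<zeta>}"
  proof -
    have "l1_dist \<mu> \<zeta> < 1 \<longleftrightarrow> \<mu> = \<zeta>" for \<mu>
      using l1_dist_nonneg[of \<mu> \<zeta>] l1_dist_eq_0_iff[of \<mu> \<zeta>] by linarith
    then show ?thesis by (auto simp: l1_ball_def)
  qed
  have "\<zeta> \<in> centers_of_Delta K 1 \<longleftrightarrow>
      Delta K \<zeta> = 1 \<and> {\<zeta>} \<in> components (positive K) \<and> {\<zeta>} \<subseteq> balanced \<inter> positive K"
    using ball unfolding centers_of_Delta_def centers_def is_center_def by auto
  then show ?thesis
    unfolding component_singleton_iff by (auto simp: positive_def)
qed

text \<open>Translation by 1 permutes the field, so comparing the sums over all elements gives p = 0
  in the field.\<close>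

lemma CHAR_eq_CARD:
  assumes "prime p" "CARD('k::field) = p"
  shows "CHAR('k) = p"
proof -
  have fin: "finite (UNIV :: 'k set)"
    using assms card_ge_0_finite prime_gt_0_nat by metis
  have "bij (\<lambda>x :: 'k. x + 1)"
    by (rule bij_betw_byWitness[of _ "\<lambda>x. x - 1"]) auto
  then have "(\<Sum>x\<in>UNIV. x + 1 :: 'k) = (\<Sum>x\<in>UNIV. x)"
    by (rule sum.reindex_bij_betw)
  then have "of_nat p = (0 :: 'k)" by (simp add: sum.distrib assms(2))
  then have "CHAR('k) dvd p" by (simp add: of_nat_eq_0_iff_char_dvd)
  then show ?thesis
    using assms(1) CHAR_not_1'[where ?'a = 'k] unfolding prime_nat_iff One_nat_def by blast
qed

text \<open>Additivity makes Frobenius injective, hence surjective on a finite field.\<close>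

lemma finite_field_CHAR_root:
  assumes "finite (UNIV :: 'k::field set)" "prime CHAR('k)"
  shows "\<exists>b. (c :: 'k) = b ^ CHAR('k)"
proof -
  have "inj (\<lambda>b :: 'k. b ^ CHAR('k))"
  proof (rule injI)
    fix a b :: 'k
    assume "a ^ CHAR('k) = b ^ CHAR('k)"
    moreover have "a ^ CHAR('k) = (a - b) ^ CHAR('k) + b ^ CHAR('k)"
      using freshmans_dream[OF assms(2) refl, of "a - b" b] by simp
    ultimately show "a = b" by simp
  qed
  then have "surj (\<lambda>b :: 'k. b ^ CHAR('k))"
    using assms(1) finite_UNIV_inj_surj by blast
  then show ?thesis by (metis surjD)
qed

theorem theorem3p2:
  fixes p :: nat
  assumes "prime p"
    and "CARD('k::field) = p"
  shows "centers_of_Delta TYPE('k) 1 =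
    balanced_odd - (\<Union>m\<in>{m::nat. m > 0}. l1_balls ((\<lambda>\<nu>. p ^ m *s \<nu>) ` balanced_odd) (p ^ m))"
proof -
  let ?\<Delta> = "Delta TYPE('k)"
  have CHAR: "CHAR('k) = p" using CHAR_eq_CARD[OF assms] .
  have p: "prime CHAR('k)" using assms(1) CHAR by simp
  have p2: "2 \<le> p" using assms(1) prime_ge_2_nat by blast
  have "finite (UNIV :: 'k set)"
    using assms card_ge_0_finite prime_gt_0_nat by metis
  then have surj: "\<exists>b. c = b ^ CHAR('k)" for c :: 'k
    using finite_field_CHAR_root p by blast
  have parity: "odd (total \<mu>) \<longleftrightarrow> odd (?\<Delta> \<mu>)" for \<mu>
    unfolding Delta_eq[where ?'k = 'k, of \<mu>, symmetric] by simp
  \<comment> \<open>The summand 2 leaves a slack of one: every neighbour of \<open>\<mu>\<close>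
    also lies in the open ball. This is used below for neighbours of a candidate center.\<close>
  have covered: "\<exists>m>0. \<exists>\<nu>\<in>balanced_odd. l1_dist \<mu> (p ^ m *s \<nu>) + 2 \<le> int (p ^ m)"
    if \<mu>: "\<mu> \<in> balanced" "2 \<le> ?\<Delta> \<mu>" for \<mu>
  proof -
    obtain \<eta> where \<eta>: "\<eta> \<in> balanced" "local_max TYPE('k) \<eta>"
        "l1_dist \<mu> \<eta> + int (?\<Delta> \<mu>) \<le> int (?\<Delta> \<eta>)"
      using climb_to_local_max[where ?'k = 'k, OF \<mu>(1)] \<mu>(2) by auto
    then have big: "2 \<le> ?\<Delta> \<eta>" using \<mu>(2) l1_dist_nonneg[of \<mu> \<eta>] by linarith
    then have "0 < ?\<Delta> \<eta>" by simp
    from local_max_is_CHAR_power_scale[OF p surj \<eta>(1,2) this] obtain m \<nu> where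
      m: "\<nu> \<in> balanced" "\<eta> = p ^ m *s \<nu>" "?\<Delta> \<nu> = 1" "?\<Delta> \<eta> = p ^ m"
      unfolding CHAR by blast
    have "m > 0" using big m(4) by (intro gr0I) simp
    moreover have "\<nu> \<in> balanced_odd" using m(1,3) parity[of \<nu>] by (simp add: balanced_odd_def)
    moreover have "l1_dist \<mu> (p ^ m *s \<nu>) + 2 \<le> int (p ^ m)"
      using \<eta>(3) m(2,4) \<mu>(2) by simp
    ultimately show ?thesis by blast
  qed
  have scaled: "p ^ m \<le> ?\<Delta> (p ^ m *s \<nu>)" if "\<nu> \<in> balanced_odd" for m \<nu>
  proof -
    have "1 \<le> ?\<Delta> \<nu>" using that parity[of \<nu>] by (simp add: balanced_odd_def odd_pos Suc_le_eq One_nat_def)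
    then have "p ^ m * 1 \<le> p ^ m * ?\<Delta> \<nu>" by (rule mult_le_mono2)
    also have "\<dots> \<le> ?\<Delta> (p ^ m *s \<nu>)"
      using Delta_CHAR_power_scale[OF p, of m \<nu>] by (simp add: CHAR)
    finally show ?thesis by simp
  qed
  show ?thesis
  proof (intro set_eqI iffI)
    fix \<zeta> assume "\<zeta> \<in> centers_of_Delta TYPE('k) 1"
    then have \<zeta>: "\<zeta> \<in> balanced" "?\<Delta> \<zeta> = 1" "\<And>\<nu>. (\<zeta>, \<nu>) \<in> adjacency \<Longrightarrow> ?\<Delta> \<nu> = 0"
      unfolding centers_of_Delta_1_iff by auto
    \<comment> \<open>Inside the ball, a step from \<open>\<zeta>\<close> towards
      \<open>p ^ m *s \<nu>\<close> would reach a point of value 0 at distance less than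
      \<open>p ^ m - 1\<close> from a point of value at least \<open>p ^ m\<close>, against the
      Lipschitz bound.\<close>
    have "\<not> l1_dist \<zeta> (p ^ m *s \<nu>) < int (p ^ m)" if "m > 0" "\<nu> \<in> balanced_odd" for m \<nu>
    proof
      assume less: "l1_dist \<zeta> (p ^ m *s \<nu>) < int (p ^ m)"
      have "p ^ 1 \<le> p ^ m" using \<open>m > 0\<close> p2 by (intro power_increasing) auto
      then have "2 \<le> ?\<Delta> (p ^ m *s \<nu>)" using scaled[OF that(2), of m] p2 by simp
      then have "\<zeta> \<noteq> p ^ m *s \<nu>" using \<zeta>(2) by auto
      then obtain \<kappa> where \<kappa>: "(\<zeta>, \<kappa>) \<in> adjacency"
        "l1_dist \<kappa> (p ^ m *s \<nu>) = l1_dist \<zeta> (p ^ m *s \<nu>) - 1"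
        by (rule step_towards)
      then show False
        using \<zeta>(3)[OF \<kappa>(1)] less scaled[OF that(2), of m]
          Delta_lipschitz[where ?'k = 'k, of "p ^ m *s \<nu>" \<kappa>] by simp
    qed
    moreover have "\<zeta> \<in> balanced_odd" using \<zeta>(1,2) parity[of \<zeta>] by (simp add: balanced_odd_def)
    ultimately show "\<zeta> \<in> balanced_odd -
        (\<Union>m\<in>{m. m > 0}. l1_balls ((\<lambda>\<nu>. p ^ m *s \<nu>) ` balanced_odd) (p ^ m))"
      unfolding l1_balls_def l1_ball_def by blast
  next
    fix \<zeta> assume \<zeta>_mem: "\<zeta> \<in> balanced_odd -
        (\<Union>m\<in>{m. m > 0}. l1_balls ((\<lambda>\<nu>. p ^ m *s \<nu>) ` balanced_odd) (p ^ m))"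
    then have \<zeta>: "\<zeta> \<in> balanced" "odd (total \<zeta>)"
      by (simp_all add: balanced_odd_def)
    have out: "\<not> l1_dist \<zeta> (p ^ m *s \<nu>) < int (p ^ m)" if "m > 0" "\<nu> \<in> balanced_odd" for m \<nu>
      using \<zeta>_mem that unfolding l1_balls_def l1_ball_def by blast
    \<comment> \<open>For \<open>\<zeta>\<close> itself, parity then forces the value 1; for a
      neighbour, the value differs from 1 by one and so must be 0.\<close>
    have small: "?\<Delta> \<mu> < 2" if \<mu>: "\<mu> \<in> balanced" "l1_dist \<zeta> \<mu> \<le> 1" for \<mu>
    proof (rule ccontr)
      assume "\<not> ?\<Delta> \<mu> < 2"
      then obtain m \<nu> where "m > 0" "\<nu> \<in> balanced_odd" "l1_dist \<mu> (p ^ m *s \<nu>) + 2 \<le> int (p ^ m)"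
        using covered[OF \<mu>(1)] by auto
      then show False using out[of m \<nu>] \<mu>(2) l1_dist_triangle[of \<zeta> "p ^ m *s \<nu>" \<mu>] by linarith
    qed
    have "odd (?\<Delta> \<zeta>)" using \<zeta>(2) parity by simp
    moreover have "l1_dist \<zeta> \<zeta> = 0" by simp
    then have "?\<Delta> \<zeta> < 2" using small[OF \<zeta>(1)] by simp
    ultimately have one: "?\<Delta> \<zeta> = 1" by (auto simp: less_2_cases_iff)
    have "?\<Delta> \<nu> = 0" if adj: "(\<zeta>, \<nu>) \<in> adjacency" for \<nu>
    proof -
      have "\<nu> \<in> balanced" using balanced_adjacent[where ?'k = 'k, OF \<zeta>(1) _ adj] one by simp
      then have "?\<Delta> \<nu> < 2" using small l1_dist_adjacent[OF adj] by simp
      then show ?thesis using Delta_adjacent[OF adj, where ?'k = 'k] one by auto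
    qed
    then show "\<zeta> \<in> centers_of_Delta TYPE('k) 1"
      unfolding centers_of_Delta_1_iff using \<zeta>(1) one by blast
  qed
qed

end
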